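(* Let $a>b>0$, $c^2=a^2-b^2$, and let $\mathcal{E}$ be the ellipse $x^2/a^2+y^2/b^2=1$. Let $\mathcal{E}_\triangle$ be the ellipse concentric and axis-aligned with $\mathcal{E}$ with semi-axes $a_\triangle=\frac{ac^2}{a^2+3b^2}$ (along $x$) and $b_\triangle=\frac{bc^2}{3a^2+b^2}$ (along $y$). For $C$ on $\mathcal{E}_\triangle$, let $\mathcal{L}_7$ be the (elliptic) locus of the Gergonne point $X_7$ over the Poncelet family of triangles inscribed in $\mathcal{E}$ and circumscribing a circle centered at $C$, with semi-axis lengths $a_7$ (major) and $b_7$ (minor). Then the aspect ratio of $\mathcal{L}_7$ is the same for all $C$ on $\mathcal{E}_\triangle$ and is given by \[ \frac{a_7}{b_7}=\frac{2a^2+b^2}{\sqrt{2a^4+5a^2b^2+2b^4}}. \]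
   Context: For each point $C=[x_c,y_c]$ interior to $\mathcal{E}$ there is exactly one circle $\mathcal{K}$ centered at $C$, nested in $\mathcal{E}$, admitting triangles inscribed in $\mathcal{E}$ with all sides tangent to $\mathcal{K}$; its radius is $r=\big(b\sqrt{a^4-c^2x_c^2}-a\sqrt{b^4+c^2y_c^2}\big)/c^2$. By Poncelet's porism every point of $\mathcal{E}$ is then a vertex of exactly one such triangle; the Poncelet family about the circle centered at $C$ is the family of all these triangles. The locus of a triangle center is the set of its positions as the triangle ranges over the family. The Gergonne point $X_7$ is the point of concurrence of the lines from each vertex to the point where the opposite side touches the incircle. In this setting $\mathcal{L}_7$ is an ellipse whose major axis is parallel to the minor axis of $\mathcal{E}$. $\mathcal{E}_\triangle$ is the locus of centroids of all equilateral triangles inscribed in $\mathcal{E}$. *)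

theory Defs
  imports "HOL-Analysis.Analysis"
begin

(* The Euclidean plane is modelled by the type complex, with coordinates Re and Im. *)

(* The ellipse centred at p with semi-axis h parallel to the x-axis and semi-axis k parallel to
   the y-axis (h and k positive, in either order). *)
definition axis_ellipse :: "complex \<Rightarrow> real \<Rightarrow> real \<Rightarrow> complex set" where
  "axis_ellipse p h k = {z. ((Re z - Re p) / h)^2 + ((Im z - Im p) / k)^2 = 1}"

definition axis_ellipse_interior :: "complex \<Rightarrow> real \<Rightarrow> real \<Rightarrow> complex set" where
  "axis_ellipse_interior p h k = {z. ((Re z - Re p) / h)^2 + ((Im z - Im p) / k)^2 < 1}"

definition nondegenerate_triangle :: "complex \<Rightarrow> complex \<Rightarrow> complex \<Rightarrow> bool" where
  "nondegenerate_triangle P Q R \<longleftrightarrow> \<not> collinear {P, Q, R}"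

(* Tangency is a condition on the whole line PQ (exactly one common point with the circle);
   requiring T to lie on the segment excludes excircles. *)
definition touches_side :: "complex \<Rightarrow> real \<Rightarrow> complex \<Rightarrow> complex \<Rightarrow> complex \<Rightarrow> bool" where
  "touches_side C r P Q T \<longleftrightarrow>
     T \<in> closed_segment P Q \<and> affine hull {P, Q} \<inter> sphere C r = {T}"

definition is_incircle :: "complex \<Rightarrow> real \<Rightarrow> complex \<Rightarrow> complex \<Rightarrow> complex \<Rightarrow> bool" where
  "is_incircle C r P Q R \<longleftrightarrow> nondegenerate_triangle P Q R \<and> 0 < r \<and>
     (\<exists>D. touches_side C r Q R D) \<and>
     (\<exists>E. touches_side C r R P E) \<and>
     (\<exists>F. touches_side C r P Q F)"

(* X is the Gergonne point of the triangle PQR. A relation rather than a function; it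
   determines X, since the incircle is unique and the lines PD, QE, RF are distinct. *)
definition is_gergonne_point ::
    "complex \<Rightarrow> complex \<Rightarrow> complex \<Rightarrow> complex \<Rightarrow> bool" where
  "is_gergonne_point P Q R X \<longleftrightarrow>
     (\<exists>I r D E F. is_incircle I r P Q R \<and>
        touches_side I r Q R D \<and> touches_side I r R P E \<and> touches_side I r P Q F \<and>
        X \<in> affine hull {P, D} \<and> X \<in> affine hull {Q, E} \<and> X \<in> affine hull {R, F})"

(* Vertex triples of all triangles inscribed in the ellipse with semi-axes a, b about the origin
   and circumscribing a circle centred at C nested in that ellipse. The radius need not be a
   parameter: for each C only one radius admits such triangles. *)
definition poncelet_family ::
    "real \<Rightarrow> real \<Rightarrow> complex \<Rightarrow> (complex \<times> complex \<times> complex) set" where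
  "poncelet_family a b C = {(P, Q, R).
     P \<in> axis_ellipse 0 a b \<and> Q \<in> axis_ellipse 0 a b \<and> R \<in> axis_ellipse 0 a b \<and>
     (\<exists>r. is_incircle C r P Q R \<and> sphere C r \<subseteq> axis_ellipse_interior 0 a b)}"

definition gergonne_locus :: "real \<Rightarrow> real \<Rightarrow> complex \<Rightarrow> complex set" where
  "gergonne_locus a b C =
     {X. \<exists>P Q R. (P, Q, R) \<in> poncelet_family a b C \<and> is_gergonne_point P Q R X}"

end

theory Submission
  imports Defs "HOL-Computational_Algebra.Fundamental_Theorem_Algebra"
begin

text \<open>Move the centre C to the origin and scale the incircle to the unit circle. A triangle with
  contact points \<open>u, v, w\<close> has vertices \<open>2 v w / (v + w)\<close> etc., and its Gergonne point is the
  symmedian point of the contact triangle. Being inscribed in the ellipse means that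
  \<open>u + v + w = \<alpha> + l \<beta>\<close> with \<open>l = u v w\<close> and constants \<open>\<alpha>, \<beta>\<close> read off from the equation of the
  ellipse; conversely every unit \<open>l\<close> occurs, since \<open>u, v, w\<close> are the solutions of an equation
  \<open>B z = l\<close> for a Blaschke product \<open>B\<close> of degree three. So the Gergonne point is an explicit rational
  function of \<open>l\<close> on the unit circle.

  If C lies on the ellipse of centroids of equilateral inscribed triangles, then \<open>|\<alpha>| = \<beta>\<close> and
  \<open>\<beta> = c\<^sup>2 / (2 (a\<^sup>2 + b\<^sup>2))\<close> does not depend on C. The rational function then traces an axis-parallel
  ellipse with squared semi-axes in the ratio \<open>(3 + 2 \<beta>) : (3 - 2 \<beta>)\<close>.\<close>

section \<open>Circles tangent to the sides of a triangle\<close>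

lemma axis_ellipse_Re_le:
  assumes "0 < h" "z \<in> axis_ellipse p h k"
  shows "\<bar>Re z - Re p\<bar> \<le> h"
proof -
  have "((Re z - Re p) / h)^2 \<le> 1"
    using assms(2) zero_le_power2[of "(Im z - Im p) / k"] unfolding axis_ellipse_def mem_Collect_eq by linarith
  hence "\<bar>(Re z - Re p) / h\<bar> \<le> 1" by (simp add: abs_square_le_1)
  thus ?thesis using assms(1) by (simp add: abs_divide divide_le_eq)
qed

lemma axis_ellipse_Im_le:
  assumes "0 < k" "z \<in> axis_ellipse p h k"
  shows "\<bar>Im z - Im p\<bar> \<le> k"
proof -
  have "((Im z - Im p) / k)^2 \<le> 1"
    using assms(2) zero_le_power2[of "(Re z - Re p) / h"] unfolding axis_ellipse_def mem_Collect_eq by linarith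
  hence "\<bar>(Im z - Im p) / k\<bar> \<le> 1" by (simp add: abs_square_le_1)
  thus ?thesis using assms(1) by (simp add: abs_divide divide_le_eq)
qed

text \<open>Opposite extreme points of the inner ellipse are 2 h or 2 k apart, while the coordinates
  of the outer one vary by at most \<open>h'\<close> and \<open>k'\<close> about \<open>p'\<close>.
  Comparing the two opposite points eliminates the centres, so two equal ellipses have equal
  semi-axes before their centres are known to agree.\<close>

lemma axis_ellipse_semiaxes_le:
  assumes "0 < h" "0 < k" "0 < h'" "0 < k'" "axis_ellipse p h k \<subseteq> axis_ellipse p' h' k'"
  shows "h \<le> h'" "k \<le> k'"
proof -
  have "p + of_real h \<in> axis_ellipse p h k" "p - of_real h \<in> axis_ellipse p h k"
    "p + \<i> * of_real k \<in> axis_ellipse p h k" "p - \<i> * of_real k \<in> axis_ellipse p h k"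
    using assms(1,2) by (auto simp: axis_ellipse_def)
  hence *: "p + of_real h \<in> axis_ellipse p' h' k'" "p - of_real h \<in> axis_ellipse p' h' k'"
    "p + \<i> * of_real k \<in> axis_ellipse p' h' k'" "p - \<i> * of_real k \<in> axis_ellipse p' h' k'"
    using assms(5) by auto
  show "h \<le> h'"
    using *(1,2)[THEN axis_ellipse_Re_le[OF assms(3)]] by simp
  show "k \<le> k'"
    using *(3,4)[THEN axis_ellipse_Im_le[OF assms(4)]] by simp
qed

section \<open>Tangency as orthogonality, and touching points from side lengths\<close>

lemma touches_side_commute: "touches_side C r P Q T \<longleftrightarrow> touches_side C r Q P T"
  by (simp add: touches_side_def closed_segment_commute insert_commute)

lemma touches_side_radius: "touches_side C r P Q T \<Longrightarrow> norm (T - C) = r"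
  by (auto simp: touches_side_def dist_norm norm_minus_commute)

text \<open>If the radius to T were oblique to the line, the mirror image of T in the foot of the
  perpendicular from C would be a second common point with the circle.\<close>

lemma touches_side_orthogonal:
  assumes "touches_side C r P Q T"
  shows "(P - T) \<bullet> (T - C) = 0"
proof (cases "P = T")
  case False
  define d where "d = P - T"
  \<comment> \<open>The parameter of that mirror image: the nonzero root, if there is one, of |T + t
    d - C|^2 = |T - C|^2.\<close>
  define t where "t = - 2 * (d \<bullet> (T - C)) / (d \<bullet> d)"
  have d: "d \<bullet> d \<noteq> 0" using False by (simp add: d_def)
  have hull: "affine hull {P, Q} \<inter> sphere C r = {T}" using assms by (simp add: touches_side_def)
  have "(1 - t) *\<^sub>R T + t *\<^sub>R P \<in> affine hull {P, Q}"
    by (rule mem_affine[OF affine_affine_hull]) (use hull in \<open>auto intro: hull_inc\<close>)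
  hence "T + t *\<^sub>R d \<in> affine hull {P, Q}" by (simp add: d_def algebra_simps)
  moreover have "norm (T + t *\<^sub>R d - C) = norm (T - C)"
  proof -
    have "(T + t *\<^sub>R d - C) \<bullet> (T + t *\<^sub>R d - C)
        = (T - C) \<bullet> (T - C) + t * (2 * (d \<bullet> (T - C)) + t * (d \<bullet> d))"
      by (simp add: inner_diff_left inner_diff_right inner_add_left inner_add_right inner_commute algebra_simps)
    moreover have "2 * (d \<bullet> (T - C)) + t * (d \<bullet> d) = 0" using d by (simp add: t_def)
    ultimately show ?thesis by (simp add: norm_eq_sqrt_inner)
  qed
  ultimately have "T + t *\<^sub>R d \<in> {T}"
    using touches_side_radius[OF assms] unfolding hull[symmetric]
    by (simp add: dist_norm norm_minus_commute)
  hence "t = 0" using d by auto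
  thus ?thesis using d by (simp add: t_def d_def)
qed simp

text \<open>Pythagoras: for z on the line, |z - C|^2 = |T - C|^2 + |z - T|^2, so only T lies on the
  circle.\<close>

lemma touches_sideI:
  assumes "norm (T - C) = r" "T \<in> closed_segment P Q" "(P - Q) \<bullet> (T - C) = 0"
  shows "touches_side C r P Q T"
proof -
  have T: "T \<in> affine hull {P, Q}"
    using assms(2) by (metis convex_hull_subset_affine_hull segment_convex_hull subsetD)
  have "z = T" if "z \<in> affine hull {P, Q}" "dist C z = r" for z
  proof -
    have "z \<in> range (\<lambda>t. Q + t *\<^sub>R (P - Q))" "T \<in> range (\<lambda>t. Q + t *\<^sub>R (P - Q))"
      using that(1) T unfolding insert_commute[of P Q] affine_hull_2_alt by auto
    then obtain s t where s: "z = Q + s *\<^sub>R (P - Q)" and t: "T = Q + t *\<^sub>R (P - Q)"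
      by blast
    have e: "z - T = (s - t) *\<^sub>R (P - Q)" unfolding s t by (simp add: algebra_simps)
    have "(z - C) \<bullet> (z - C) = (T - C) \<bullet> (T - C) + 2 * ((z - T) \<bullet> (T - C)) + (z - T) \<bullet> (z - T)"
      by (simp add: inner_diff_left inner_diff_right inner_commute algebra_simps)
    moreover have "(z - T) \<bullet> (T - C) = 0" using e assms(3) by simp
    moreover have "(z - C) \<bullet> (z - C) = (T - C) \<bullet> (T - C)"
      using that(2) assms(1) by (metis dist_commute dist_norm norm_eq)
    ultimately show "z = T" by simp
  qed
  hence "affine hull {P, Q} \<inter> sphere C r \<subseteq> {T}" by auto
  moreover have "T \<in> sphere C r" using assms(1) by (simp add: dist_norm norm_minus_commute)
  ultimately have "affine hull {P, Q} \<inter> sphere C r = {T}" using T by blast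
  thus ?thesis using assms(2) by (simp add: touches_side_def)
qed

text \<open>Both squared lengths equal the power of P with respect to the circle, |P - C|^2 -
  r^2.\<close>

lemma touches_side_tangent_length:
  assumes "touches_side C r P Q T" "touches_side C r P R S"
  shows "dist P T = dist P S"
proof -
  have *: "(dist P T)^2 = (dist P C)^2 - r^2" if "touches_side C r P Q T" for Q T
  proof -
    have "(P - C) \<bullet> (P - C) = (P - T) \<bullet> (P - T) + 2 * ((P - T) \<bullet> (T - C)) + (T - C) \<bullet> (T - C)"
      by (simp add: inner_diff_left inner_diff_right inner_commute algebra_simps)
    thus ?thesis
      using touches_side_orthogonal[OF that] touches_side_radius[OF that]
      by (simp add: dist_norm flip: power2_norm_eq_inner)
  qed
  show ?thesis using *[OF assms(1)] *[OF assms(2)] by (metis power2_eq_iff_nonneg zero_le_dist)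
qed

text \<open>Each touching point lies on its segment, so a side is the sum of two tangent lengths,
  and the two tangent lengths from a vertex agree. The position of D is thus fixed by the side
  lengths alone.\<close>

lemma touch_point_dist:
  assumes "touches_side C r Q R D" "touches_side C r R P E" "touches_side C r P Q F"
  shows "2 * dist Q D = dist Q R + dist P Q - dist R P"
proof -
  have "dist Q R = dist Q D + dist D R" "dist R P = dist R E + dist E P" "dist P Q = dist P F + dist F Q"
    using assms by (auto simp: touches_side_def between_mem_segment[symmetric] between)
  moreover have "dist Q D = dist Q F" "dist R D = dist R E" "dist P E = dist P F"
    using assms touches_side_tangent_length by (metis touches_side_commute)+
  ultimately show ?thesis by (simp add: dist_commute)
qed

text \<open>Lets the circle in \<open>is_gergonne_point\<close> be exchanged for the one in
  \<open>poncelet_family\<close> without comparing centres or radii.\<close>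

lemma touch_point_unique:
  assumes "touches_side C r Q R D" "touches_side C r R P E" "touches_side C r P Q F"
    and "touches_side C' r' Q R D'" "touches_side C' r' R P E'" "touches_side C' r' P Q F'"
  shows "D = D'"
proof -
  have eq: "dist Q D = dist Q D'"
    using touch_point_dist[OF assms(1-3)] touch_point_dist[OF assms(4-6)] by simp
  obtain s t where st: "0 \<le> s" "0 \<le> t" "D = Q + s *\<^sub>R (R - Q)" "D' = Q + t *\<^sub>R (R - Q)"
    using assms(1,4) unfolding touches_side_def closed_segment_def
    by (auto simp: algebra_simps)
  hence "s * norm (R - Q) = t * norm (R - Q)" using eq by (simp add: dist_norm)
  thus ?thesis using st by auto
qed

section \<open>Contact points as coordinates\<close>

text \<open>The pole of the chord v w: the intersection of the tangents to the unit circle at v and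
  w. If v + w = 0 the tangents are parallel (or v = w = 0) and the value is the default 0.\<close>

definition tangent_meet :: "complex \<Rightarrow> complex \<Rightarrow> complex" where
  "tangent_meet v w = 2 * v * w / (v + w)"

lemma tangent_meet_commute: "tangent_meet v w = tangent_meet w v"
  by (simp add: tangent_meet_def ac_simps)

lemma cnj_unit:
  assumes "cmod u = 1"
  shows "cnj u = 1 / u" "u \<noteq> 0"
proof -
  show "u \<noteq> 0" using assms by auto
  thus "cnj u = 1 / u" using assms complex_norm_square[of u] by (simp add: field_simps)
qed

lemma cnj_tangent_meet:
  assumes "cmod v = 1" "cmod w = 1"
  shows "cnj (tangent_meet v w) = 2 / (v + w)"
proof -
  have "cnj (tangent_meet v w) = 2 / (v * w * (1 / v + 1 / w))"
    by (simp add: tangent_meet_def cnj_unit assms)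
  also have "v * w * (1 / v + 1 / w) = v + w"
    using cnj_unit(2)[OF assms(1)] cnj_unit(2)[OF assms(2)] by (simp add: field_simps)
  finally show ?thesis .
qed

lemma inner_complex_Re_cnj: "2 * complex_of_real (z \<bullet> w) = z * cnj w + cnj z * w"
  by (simp add: inner_complex_def complex_eq_iff)

text \<open>For unit v the tangent condition reads p + cnj p * v^2 = 2 v. The two conditions are
  linear in p and cnj p; subtracting them and cancelling v - w leaves cnj p * (v + w) = 2.\<close>

lemma tangent_meetI:
  assumes "cmod v = 1" "cmod w = 1" "v \<noteq> w" "p \<bullet> v = 1" "p \<bullet> w = 1"
  shows "v + w \<noteq> 0" "p = tangent_meet v w"
proof -
  have *: "p + cnj p * v\<^sup>2 = 2 * v" if "cmod v = 1" "p \<bullet> v = 1" for v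
  proof -
    have "p * (1 / v) + cnj p * v = 2"
      using inner_complex_Re_cnj[of p v] that by (simp add: cnj_unit)
    thus ?thesis using cnj_unit(2)[OF that(1)] by (simp add: field_simps power2_eq_square)
  qed
  note vw = *[OF assms(1,4)] *[OF assms(2,5)]
  have "(v - w) * (cnj p * (v + w) - 2) = 0"
    using vw by algebra
  hence c: "cnj p * (v + w) = 2" using assms(3) by simp
  thus nz: "v + w \<noteq> 0" by auto
  have "p * (v + w) = 2 * v * w" using vw c by algebra
  thus "p = tangent_meet v w" using nz by (simp add: tangent_meet_def field_simps)
qed

lemma collinear_orthogonal:
  fixes n :: complex
  assumes "n \<noteq> 0" "\<And>x y. x \<in> S \<Longrightarrow> y \<in> S \<Longrightarrow> (x - y) \<bullet> n = 0"
  shows "collinear S"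
  unfolding collinear_def
proof (intro exI ballI)
  fix x y assume "x \<in> S" "y \<in> S"
  hence 0: "Re (x - y) * Re n + Im (x - y) * Im n = 0"
    using assms(2) by (simp add: inner_complex_def)
  have n: "Re n * Re n + Im n * Im n \<noteq> 0"
    using assms(1) by (simp add: complex_eq_iff sum_squares_eq_zero_iff)
  \<comment> \<open>The coefficient of x - y along \<i> * n, the direction orthogonal to n.\<close>
  define t where "t = (Im (x - y) * Re n - Re (x - y) * Im n) / (Re n * Re n + Im n * Im n)"
  have t: "t * (Re n * Re n + Im n * Im n) = Im (x - y) * Re n - Re (x - y) * Im n"
    using n by (simp add: t_def)
  have "(Re n * Re n + Im n * Im n) * (Re (x - y) + t * Im n) = 0"
    "(Re n * Re n + Im n * Im n) * (Im (x - y) - t * Re n) = 0"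
    using 0 t by algebra+
  hence "Re (x - y) + t * Im n = 0" "Im (x - y) - t * Re n = 0" using n by auto
  thus "x - y = t *\<^sub>R (\<i> * n)" by (simp add: complex_eq_iff)
qed

text \<open>With a common touching point, both sides would lie on the tangent there, and the
  triangle would degenerate.\<close>

lemma touch_points_distinct:
  assumes "\<not> collinear {P, Q, R}" "0 < r" "touches_side C r R P E" "touches_side C r P Q F"
  shows "E \<noteq> F"
proof
  assume "E = F"
  define n where "n = E - C"
  have n: "n \<noteq> 0" using touches_side_radius[OF assms(3)] assms(2) by (auto simp: n_def)
  have "(P - E) \<bullet> n = 0" "(R - E) \<bullet> n = 0" "(Q - E) \<bullet> n = 0"
    using assms(3,4) touches_side_orthogonal touches_side_commute \<open>E = F\<close> unfolding n_def by metis+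
  hence "P \<bullet> n = E \<bullet> n" "R \<bullet> n = E \<bullet> n" "Q \<bullet> n = E \<bullet> n"
    by (simp_all add: inner_diff_left)
  hence "collinear {P, Q, R}"
    by (intro collinear_orthogonal[OF n]) (auto simp: inner_diff_left)
  thus False using assms(1) by simp
qed

lemma touch_coordinate:
  assumes "0 < r" "touches_side C r P Q T"
  shows "cmod ((T - C) / r) = 1" "((P - C) / r) \<bullet> ((T - C) / r) = 1" "((Q - C) / r) \<bullet> ((T - C) / r) = 1"
proof -
  show "cmod ((T - C) / r) = 1"
    using touches_side_radius[OF assms(2)] assms(1) by (simp add: norm_divide)
  have *: "((P - C) / r) \<bullet> ((T - C) / r) = 1" if "touches_side C r P Q T" for P Q
  proof -
    have "(P - C) \<bullet> (T - C) = (P - T) \<bullet> (T - C) + (T - C) \<bullet> (T - C)"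
      by (simp add: inner_diff_left)
    also have "\<dots> = r^2"
      using touches_side_orthogonal[OF that] touches_side_radius[OF that]
      by (simp flip: power2_norm_eq_inner)
    finally have *: "(P - C) \<bullet> (T - C) = r^2" .
    have "((P - C) / r) \<bullet> ((T - C) / r) = ((P - C) \<bullet> (T - C)) / r^2"
      by (simp add: inner_complex_def add_divide_distrib power2_eq_square)
    thus ?thesis unfolding * using assms(1) by simp
  qed
  show "((P - C) / r) \<bullet> ((T - C) / r) = 1" "((Q - C) / r) \<bullet> ((T - C) / r) = 1"
    using *[of P Q] *[of Q P] assms(2) touches_side_commute by auto
qed

lemma touch_vertex:
  assumes "0 < r" "E \<noteq> F" "touches_side C r R P E" "touches_side C r P Q F"
    and v: "v = (E - C) / of_real r" and w: "w = (F - C) / of_real r"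
  shows "v + w \<noteq> 0" "P = C + of_real r * tangent_meet v w" "v \<noteq> w"
proof -
  show ne: "v \<noteq> w" using assms(1,2) by (simp add: v w)
  have *: "cmod v = 1" "cmod w = 1" "((P - C) / of_real r) \<bullet> v = 1" "((P - C) / of_real r) \<bullet> w = 1"
    using touch_coordinate[OF assms(1,3)] touch_coordinate[OF assms(1,4)] v w by auto
  show "v + w \<noteq> 0" using tangent_meetI[OF *(1,2) ne *(3,4)] by simp
  have "(P - C) / of_real r = tangent_meet v w" using tangent_meetI[OF *(1,2) ne *(3,4)] by simp
  moreover have "P = C + of_real r * ((P - C) / of_real r)" using assms(1) by simp
  ultimately show "P = C + of_real r * tangent_meet v w" by simp
qed

text \<open>Each vertex is the meet of the tangents at the contact points of its two sides, so the
  unit numbers u, v, w encode the whole triangle; u belongs to the side opposite P, v to that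
  opposite Q, w to that opposite R.\<close>

lemma touch_coordinates:
  assumes "\<not> collinear {P, Q, R}" "0 < r"
    and "touches_side C r Q R D" "touches_side C r R P E" "touches_side C r P Q F"
  obtains u v w where "cmod u = 1" "cmod v = 1" "cmod w = 1" "u \<noteq> v" "v \<noteq> w" "w \<noteq> u"
    "u + v \<noteq> 0" "v + w \<noteq> 0" "w + u \<noteq> 0"
    "D = C + of_real r * u" "E = C + of_real r * v" "F = C + of_real r * w"
    "P = C + of_real r * tangent_meet v w" "Q = C + of_real r * tangent_meet w u"
    "R = C + of_real r * tangent_meet u v"
proof -
  define u v w where uvw: "u = (D - C) / of_real r" "v = (E - C) / of_real r" "w = (F - C) / of_real r"
  have ne: "E \<noteq> F" "F \<noteq> D" "D \<noteq> E"
    using touch_points_distinct[of P Q R r C E F] touch_points_distinct[of Q R P r C F D]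
      touch_points_distinct[of R P Q r C D E] assms by (auto simp: insert_commute)
  show ?thesis
  proof (rule that[of u v w])
    show "cmod u = 1" "cmod v = 1" "cmod w = 1"
      using touch_coordinate(1)[OF assms(2)] assms(3-5) unfolding uvw by blast+
    show "D = C + of_real r * u" "E = C + of_real r * v" "F = C + of_real r * w"
      using assms(2) by (simp_all add: uvw)
  qed (use touch_vertex[OF assms(2) ne(1) assms(4,5) uvw(2,3)] touch_vertex[OF assms(2) ne(2) assms(5,3) uvw(3,1)]
      touch_vertex[OF assms(2) ne(3) assms(3,4) uvw(1,2)] in auto)
qed

section \<open>Triangles built from acute contact triples\<close>

lemma unit_ratio_imaginary:
  assumes "cmod u = 1" "cmod v = 1"
  shows "(v - u) / (v + u) = \<i> * of_real (Im ((v - u) / (v + u)))"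
proof -
  \<comment> \<open>Conjugation inverts unit numbers and so negates the ratio. When v + u is
    nonzero, the ratio is \<i> times the tangent of half the angle from u to v.\<close>
  have "cnj ((v - u) / (v + u)) = (u * v * (1 / v - 1 / u)) / (u * v * (1 / v + 1 / u))"
    using assms by (simp add: cnj_unit)
  also have "\<dots> = (u - v) / (u + v)"
    using assms[THEN cnj_unit(2)] by (simp add: distrib_left right_diff_distrib add.commute)
  also have "\<dots> = - ((v - u) / (v + u))" by (simp add: minus_divide_left add.commute)
  finally have "Re (cnj ((v - u) / (v + u))) = Re (- ((v - u) / (v + u)))" by simp
  hence "Re ((v - u) / (v + u)) = 0" unfolding cnj.sel uminus_complex.sel by linarith
  thus ?thesis by (simp add: complex_eq_iff)
qed

text \<open>For unit u and v the ratio is purely imaginary, and its imaginary part is the signed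
  position of the vertex on the tangent at u, measured from u.\<close>

lemma tangent_meet_offset:
  assumes "u + v \<noteq> 0"
  shows "tangent_meet u v = u * (1 + (v - u) / (v + u))"
  using assms by (simp add: tangent_meet_def field_simps)

(* The elementary symmetric functions of unit numbers satisfy (u + v) (v + w) (w + u) =
   u v w (|u + v + w|^2 - 1), so |u + v + w| < 1 says that the triangle u v w is acute. *)
lemma acute_contact_sign:
  assumes unit: "cmod u = 1" "cmod v = 1" "cmod w = 1" and acute: "cmod (u + v + w) < 1"
    and nz: "u + v \<noteq> 0" "w + u \<noteq> 0"
  shows "Im ((w - u) / (w + u)) * Im ((v - u) / (v + u)) \<le> - 1"
proof -
  define x y where "x = Im ((w - u) / (w + u))" and "y = Im ((v - u) / (v + u))"
  define s where "s = u + v + w"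
  note n0 = unit[THEN cnj_unit(2)]
  have x: "(w - u) / (w + u) = \<i> * of_real x" and y: "(v - u) / (v + u) = \<i> * of_real y"
    unfolding x_def y_def using unit_ratio_imaginary unit by blast+
  have "(1 + of_real (x * y)) = 1 - (w - u) / (w + u) * ((v - u) / (v + u))"
    unfolding x y by (simp add: algebra_simps)
  also have "\<dots> = 2 * u * (v + w) / ((w + u) * (v + u))"
    using nz by (simp add: divide_simps add.commute) (simp add: algebra_simps)
  finally have 1: "1 + of_real (x * y) = 2 * u * (v + w) / ((w + u) * (v + u))" .
  have 2: "of_real (1 - (cmod s)\<^sup>2) = - (u + v) * (v + w) * (w + u) / (u * v * w)"
    unfolding of_real_diff complex_norm_square s_def using n0
    by (simp add: cnj_unit unit field_simps)
  have 3: "of_real ((cmod (v + w))\<^sup>2) = (v + w) * (v + w) / (v * w)"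
    unfolding complex_norm_square using n0
    by (simp add: cnj_unit unit field_simps)
  define N S T where NST: "N = 1 + complex_of_real (x * y)" "S = complex_of_real (1 - (cmod s)\<^sup>2)"
    "T = complex_of_real ((cmod (v + w))\<^sup>2)"
  have "N * ((w + u) * (v + u)) = 2 * u * (v + w)" "S * (u * v * w) = - (u + v) * (v + w) * (w + u)"
    "T * (v * w) = (v + w) * (v + w)"
    unfolding NST 1 2 3 using n0 nz by (simp_all add: add.commute)
  \<comment> \<open>Multiplying the first two relations gives (1 + x y) (1 - |s|^2) = - 2 |v + w|^2;
    acuteness makes the second factor positive.\<close>
  hence "u * v * w * (N * S + 2 * T) = 0" by algebra
  hence "N * S + 2 * T = 0" using n0 by simp
  hence "complex_of_real ((1 + x * y) * (1 - (cmod s)\<^sup>2) + 2 * (cmod (v + w))\<^sup>2) = 0"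
    unfolding NST by simp
  hence "(1 + x * y) * (1 - (cmod s)\<^sup>2) + 2 * (cmod (v + w))\<^sup>2 = 0"
    by (simp only: of_real_eq_0_iff)
  moreover have "0 < 1 - (cmod s)\<^sup>2" using acute by (simp add: s_def abs_square_less_1)
  ultimately have "\<not> 0 < 1 + x * y"
    using mult_pos_pos[of "1 + x * y" "1 - (cmod s)\<^sup>2"] zero_le_power2[of "cmod (v + w)"] by linarith
  thus ?thesis by (simp add: x_def y_def)
qed

lemma unit_sum_nonzero:
  assumes "cmod w = 1" "cmod (u + v + w) < 1"
  shows "u + v \<noteq> 0"
  using assms by auto

text \<open>In the unit picture the two vertices on the tangent at u are u (1 + \<i> x) and u (1 +
  \<i> y). By \<open>acute_contact_sign\<close> x and y have opposite signs, so u lies between the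
  vertices and the circle is not an excircle.\<close>

lemma touches_side_tangent_meet:
  assumes r: "0 < r" and unit: "cmod u = 1" "cmod v = 1" "cmod w = 1"
    and acute: "cmod (u + v + w) < 1"
  shows "touches_side C r (C + of_real r * tangent_meet w u) (C + of_real r * tangent_meet u v)
     (C + of_real r * u)" (is "touches_side _ _ ?Q ?R ?D")
    and "C + of_real r * tangent_meet w u \<noteq> C + of_real r * tangent_meet u v"
proof -
  have nz: "u + v \<noteq> 0" "w + u \<noteq> 0"
    using unit_sum_nonzero[of w u v] unit_sum_nonzero[of v w u] unit acute by (auto simp: ac_simps)
  define x y where "x = Im ((w - u) / (w + u))" and "y = Im ((v - u) / (v + u))"
  have xy: "x * y \<le> - 1" unfolding x_def y_def by (rule acute_contact_sign) fact+
  hence ne: "x \<noteq> y" by (smt (verit) zero_le_square)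
  have x: "(w - u) / (w + u) = \<i> * of_real x" and y: "(v - u) / (v + u) = \<i> * of_real y"
    unfolding x_def y_def using unit_ratio_imaginary unit by blast+
  have Q: "?Q = C + of_real r * (u * (1 + \<i> * of_real x))"
    using tangent_meet_offset[of u w] nz(2) unfolding tangent_meet_commute[of w u] add.commute[of u w] x
    by simp
  have R: "?R = C + of_real r * (u * (1 + \<i> * of_real y))"
    using tangent_meet_offset[of u v] nz(1) unfolding y by simp
  have QR: "?Q - ?R = of_real (r * (x - y)) * (\<i> * u)"
    unfolding Q R by (simp add: algebra_simps)
  show "?Q \<noteq> ?R" using QR ne r cnj_unit(2)[OF unit(1)] by auto
  show "touches_side C r ?Q ?R ?D"
  proof (rule touches_sideI)
    show "cmod (?D - C) = r" using r unit by (simp add: norm_mult)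
    show "(?Q - ?R) \<bullet> (?D - C) = 0" unfolding QR by (simp add: inner_complex_def algebra_simps)
    \<comment> \<open>Solves (1 - t) x + t y = 0, the condition that the offset from u
      vanishes.\<close>
    define t where "t = x / (x - y)"
    have "0 \<le> t \<and> t \<le> 1"
    proof (cases "x > 0")
      case True
      hence "y < 0" using xy by (smt (verit) mult_nonneg_nonneg)
      thus ?thesis using True by (simp add: t_def)
    next
      case False
      hence "x < 0" using xy by (cases "x = 0") auto
      moreover from this have "y > 0" using xy by (smt (verit) mult_nonpos_nonpos)
      ultimately show ?thesis by (simp add: t_def divide_nonpos_neg divide_le_eq)
    qed
    moreover have "?D = (1 - t) *\<^sub>R ?Q + t *\<^sub>R ?R"
    proof -
      have "(1 - t) * x + t * y = 0" using ne by (simp add: t_def field_simps)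
      hence "complex_of_real ((1 - t) * x + t * y) = 0" by simp
      moreover have "(1 - t) *\<^sub>R ?Q + t *\<^sub>R ?R = ?D + of_real r * u * \<i> * of_real ((1 - t) * x + t * y)"
        unfolding Q R by (simp add: scaleR_conv_of_real algebra_simps)
      ultimately show ?thesis by simp
    qed
    ultimately show "?D \<in> closed_segment ?Q ?R" by (auto simp: in_segment)
  qed
qed

text \<open>The three tangencies are cyclic copies of one. Were the vertices collinear, the contact
  point of v would be a second common point of line QR and the circle.\<close>

lemma is_incircle_tangent_meet:
  assumes r: "0 < r" and unit: "cmod u = 1" "cmod v = 1" "cmod w = 1"
    and acute: "cmod (u + v + w) < 1" and ne: "u \<noteq> v"
  shows "is_incircle C r (C + of_real r * tangent_meet v w) (C + of_real r * tangent_meet w u)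
    (C + of_real r * tangent_meet u v)" (is "is_incircle _ _ ?P ?Q ?R")
    and "touches_side C r (C + of_real r * tangent_meet w u) (C + of_real r * tangent_meet u v) (C + of_real r * u)"
    and "touches_side C r (C + of_real r * tangent_meet u v) (C + of_real r * tangent_meet v w) (C + of_real r * v)"
    and "touches_side C r (C + of_real r * tangent_meet v w) (C + of_real r * tangent_meet w u) (C + of_real r * w)"
proof -
  show D: "touches_side C r ?Q ?R (C + of_real r * u)"
    using touches_side_tangent_meet[of r u v w] assms by simp
  show E: "touches_side C r ?R ?P (C + of_real r * v)"
    using touches_side_tangent_meet[of r v w u] assms by (simp add: ac_simps)
  show F: "touches_side C r ?P ?Q (C + of_real r * w)"
    using touches_side_tangent_meet[of r w u v] assms by (simp add: ac_simps)
  have QR: "?Q \<noteq> ?R" using touches_side_tangent_meet(2)[of r u v w] assms by simp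
  have "\<not> collinear {?Q, ?R, ?P}"
  proof
    assume "collinear {?Q, ?R, ?P}"
    hence "?P \<in> affine hull {?Q, ?R}" using collinear_3_affine_hull[OF QR] by simp
    moreover have "?R \<in> affine hull {?Q, ?R}" by (simp add: hull_inc)
    ultimately have "closed_segment ?R ?P \<subseteq> affine hull {?Q, ?R}"
      by (simp add: closed_segment_subset affine_imp_convex)
    hence "C + of_real r * v \<in> affine hull {?Q, ?R} \<inter> sphere C r"
      using E by (auto simp: touches_side_def)
    hence "C + of_real r * v = C + of_real r * u"
      using D unfolding touches_side_def by (metis singletonD)
    thus False using r ne by simp
  qed
  hence "nondegenerate_triangle ?P ?Q ?R"
    by (simp add: nondegenerate_triangle_def insert_commute)
  thus "is_incircle C r ?P ?Q ?R" using r D E F by (auto simp: is_incircle_def)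
qed

section \<open>The Gergonne point as a symmedian point\<close>

(* The symmedian point of a triangle u v w inscribed in the unit circle, which is the Gergonne
   point of its tangential triangle, in terms of l = u v w and s = u + v + w: the barycentric
   weights |v - w|^2, |w - u|^2, |u - v|^2 have sum 9 - |s|^2. *)
definition gergonne_coord :: "complex \<Rightarrow> complex \<Rightarrow> complex" where
  "gergonne_coord l s = (6 * s - 2 * l * (cnj s)\<^sup>2) / (9 - of_real ((cmod s)\<^sup>2))"

text \<open>Conjugation inverts unit numbers; hence sum and product of the contact points already
  determine the second elementary symmetric function.\<close>

lemma cnj_sum_unit:
  assumes "cmod u = 1" "cmod v = 1" "cmod w = 1"
  shows "u * v * w * cnj (u + v + w) = u * v + v * w + w * u"
  using assms by (simp add: cnj_unit field_simps)

lemma affine_hull_pair_iff: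
  fixes x p u :: complex
  assumes "p \<noteq> u"
  shows "x \<in> affine hull {p, u} \<longleftrightarrow> (x - u) * cnj (p - u) = cnj (x - u) * (p - u)"
proof
  assume "x \<in> affine hull {p, u}"
  then obtain t where "x = u + t *\<^sub>R (p - u)"
    unfolding insert_commute[of p u] affine_hull_2_alt by auto
  hence "x - u = of_real t * (p - u)" by (simp add: scaleR_conv_of_real)
  thus "(x - u) * cnj (p - u) = cnj (x - u) * (p - u)" by simp
next
  assume *: "(x - u) * cnj (p - u) = cnj (x - u) * (p - u)"
  define t where "t = Re ((x - u) * cnj (p - u)) / (cmod (p - u))\<^sup>2"
  have "cnj ((x - u) * cnj (p - u)) = (x - u) * cnj (p - u)" using * by simp
  hence "(x - u) * cnj (p - u) = of_real (Re ((x - u) * cnj (p - u)))"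
    by (metis Reals_cnj_iff of_real_Re)
  hence "of_real t * (of_real ((cmod (p - u))\<^sup>2)) = (x - u) * cnj (p - u)"
    using assms by (simp add: t_def)
  hence "of_real t * ((p - u) * cnj (p - u)) = (x - u) * cnj (p - u)"
    by (simp only: complex_norm_square)
  hence "of_real t * (p - u) = x - u" using assms by simp
  hence "x = u + t *\<^sub>R (p - u)" by (simp add: scaleR_conv_of_real algebra_simps)
  thus "x \<in> affine hull {p, u}"
    unfolding insert_commute[of p u] affine_hull_2_alt by blast
qed

lemma affine_hull_pair_similar:
  fixes C x p u :: complex
  assumes "r \<noteq> 0"
  shows "C + of_real r * x \<in> affine hull {C + of_real r * p, C + of_real r * u} \<longleftrightarrow> x \<in> affine hull {p, u}"
proof (cases "p = u")
  case False
  thus ?thesis using assms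
    by (simp add: affine_hull_pair_iff flip: right_diff_distrib)
qed (use assms in simp)

text \<open>Collinearity with the vertex and the contact point, multiplied by (v + w) u, loses the
  conjugates of u, v, w and becomes a linear equation in x and cnj x.\<close>

lemma cevian_equation:
  assumes "cmod u = 1" "cmod v = 1" "cmod w = 1" "v \<noteq> w" "v + w \<noteq> 0"
  shows "x \<in> affine hull {tangent_meet v w, u} \<longleftrightarrow>
    x * (2 * u - v - w) - cnj x * u * (2 * v * w - u * v - u * w) = 2 * (u\<^sup>2 - v * w)"
proof -
  define p where "p = tangent_meet v w"
  note n0 = assms(1-3)[THEN cnj_unit(2)]
  have p: "p * (v + w) = 2 * v * w" using assms(5) by (simp add: p_def tangent_meet_def)
  have cp: "cnj p * (v + w) = 2" using assms(5) unfolding p_def cnj_tangent_meet[OF assms(2,3)] by (simp only: times_divide_eq_left nonzero_mult_div_cancel_right not_False_eq_True)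
  have cu: "cnj u * u = 1" using n0 by (simp add: cnj_unit assms)
  have "p \<noteq> u"
  proof
    assume "p = u"
    have "(v + w)\<^sup>2 = cnj u * u * (v + w)\<^sup>2" using cu by simp
    also have "\<dots> = (cnj u * (v + w)) * (u * (v + w))" by (simp add: algebra_simps power2_eq_square)
    also have "\<dots> = 4 * v * w" using p cp unfolding \<open>p = u\<close> by simp
    finally have "(v - w)\<^sup>2 = 0" by (simp add: algebra_simps power2_eq_square)
    thus False using assms(4) by simp
  qed
  hence "x \<in> affine hull {p, u} \<longleftrightarrow> (x - u) * cnj (p - u) = cnj (x - u) * (p - u)"
    by (rule affine_hull_pair_iff)
  also have "\<dots> \<longleftrightarrow> (x - u) * (cnj p - cnj u) * ((v + w) * u) = (cnj x - cnj u) * (p - u) * ((v + w) * u)"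
    using assms(5) n0 by simp
  also have "(x - u) * (cnj p - cnj u) * ((v + w) * u)
      = (x - u) * (cnj p * (v + w) * u - cnj u * u * (v + w))"
    by (simp add: algebra_simps)
  also have "\<dots> = (x - u) * (2 * u - v - w)" unfolding cp cu by (simp add: algebra_simps)
  also have "(cnj x - cnj u) * (p - u) * ((v + w) * u)
      = (cnj x * u - cnj u * u) * (p * (v + w) - u * (v + w))"
    by (simp add: algebra_simps)
  also have "\<dots> = (cnj x * u - 1) * (2 * v * w - u * v - u * w)"
    unfolding p cu by (simp add: algebra_simps)
  also have "(x - u) * (2 * u - v - w) = (cnj x * u - 1) * (2 * v * w - u * v - u * w) \<longleftrightarrow>
    x * (2 * u - v - w) - cnj x * u * (2 * v * w - u * v - u * w) = 2 * (u\<^sup>2 - v * w)"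
    (is "?A = ?B \<longleftrightarrow> ?C = ?D")
  proof -
    have "?A - ?B = ?C - ?D" by (simp add: algebra_simps power2_eq_square)
    thus ?thesis by (metis eq_iff_diff_eq_0)
  qed
  finally show ?thesis by (simp add: p_def)
qed

text \<open>With s = u + v + w, \<open>n\<close> equals u v w (9 - |s|^2). Multiplication by
  \<open>n\<close> clears the denominator and all conjugates, so statements about \<open>k\<close>
  and \<open>cnj k\<close> turn into polynomial identities in u, v, w.\<close>

lemma gergonne_coord_eq:
  assumes "cmod u = 1" "cmod v = 1" "cmod w = 1" "cmod (u + v + w) < 3"
  defines "k \<equiv> gergonne_coord (u * v * w) (u + v + w)"
    and "n \<equiv> 9 * (u * v * w) - (u + v + w) * (u * v + v * w + w * u)"
  shows "n \<noteq> 0" "k * n = 6 * (u + v + w) * (u * v * w) - 2 * (u * v + v * w + w * u)\<^sup>2"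
    "cnj k * n = 6 * (u * v + v * w + w * u) - 2 * (u + v + w)\<^sup>2"
proof -
  define s l m where slm: "s = u + v + w" "l = u * v * w" "m = u * v + v * w + w * u"
  have l: "cnj l * l = 1" "l \<noteq> 0"
    using assms(1-3)[THEN cnj_unit(2)] by (simp_all add: slm cnj_unit assms(1-3))
  have m: "m = l * cnj s"
    using cnj_sum_unit[OF assms(1-3)] by (simp add: slm)
  have d: "of_real (9 - (cmod s)\<^sup>2) = 9 - s * cnj s"
    using complex_norm_square[of s] by simp
  have "(cmod s)\<^sup>2 < 3\<^sup>2" using assms(4) by (intro power_strict_mono) (auto simp: slm)
  hence "complex_of_real (9 - (cmod s)\<^sup>2) \<noteq> 0" unfolding of_real_eq_0_iff by simp
  hence d0: "9 - s * cnj s \<noteq> 0" unfolding d .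
  have n: "n = l * (9 - s * cnj s)" by (simp add: n_def m flip: slm) (simp add: algebra_simps)
  thus "n \<noteq> 0" using d0 l by simp
  have k: "k * (9 - s * cnj s) = 6 * s - 2 * l * (cnj s)\<^sup>2"
    using d d0 by (simp add: k_def gergonne_coord_def flip: slm)
  have "cnj (k * (9 - s * cnj s)) = cnj (6 * s - 2 * l * (cnj s)\<^sup>2)" unfolding k ..
  hence ck: "cnj k * (9 - cnj s * s) = 6 * cnj s - 2 * cnj l * s\<^sup>2" by simp
  have "k * n = 6 * s * l - 2 * m\<^sup>2" unfolding n m using k by algebra
  thus "k * n = 6 * (u + v + w) * (u * v * w) - 2 * (u * v + v * w + w * u)\<^sup>2" by (simp add: slm)
  have "cnj k * n = 6 * m - 2 * s\<^sup>2" unfolding n m using ck l by algebra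
  thus "cnj k * n = 6 * (u * v + v * w + w * u) - 2 * (u + v + w)\<^sup>2" by (simp add: slm)
qed

text \<open>Two cevian equations form a linear system in x and cnj x whose determinant is, up to
  sign, (u - v) n, which is nonzero. So there is at most one solution, and \<open>k\<close> solves
  all three equations.\<close>

lemma cevians_concurrent_iff:
  assumes unit: "cmod u = 1" "cmod v = 1" "cmod w = 1" and ne: "u \<noteq> v" "v \<noteq> w" "w \<noteq> u"
    and nz: "u + v \<noteq> 0" "v + w \<noteq> 0" "w + u \<noteq> 0" and s: "cmod (u + v + w) < 3"
  shows "x \<in> affine hull {tangent_meet v w, u} \<and> x \<in> affine hull {tangent_meet w u, v} \<and>
      x \<in> affine hull {tangent_meet u v, w} \<longleftrightarrow> x = gergonne_coord (u * v * w) (u + v + w)"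
proof -
  define n k where n: "n = 9 * (u * v * w) - (u + v + w) * (u * v + v * w + w * u)"
    and k: "k = gergonne_coord (u * v * w) (u + v + w)"
  note nk = gergonne_coord_eq[OF unit s, folded n k]
  let ?L = "\<lambda>x y u v w. x * (2 * u - v - w) - y * u * (2 * v * w - u * v - u * w) = 2 * (u\<^sup>2 - v * w)"
  have *: "n * (k * a - cnj k * b * c - d) = k * n * a - cnj k * n * b * c - n * d" for a b c d
    by (simp add: algebra_simps)
  have "n * (k * (2 * u - v - w) - cnj k * u * (2 * v * w - u * v - u * w) - 2 * (u\<^sup>2 - v * w)) = 0"
    "n * (k * (2 * v - w - u) - cnj k * v * (2 * w * u - v * w - v * u) - 2 * (v\<^sup>2 - w * u)) = 0"
    "n * (k * (2 * w - u - v) - cnj k * w * (2 * u * v - w * u - w * v) - 2 * (w\<^sup>2 - u * v)) = 0"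
    unfolding * nk(2,3) unfolding n by algebra+
  hence kL: "?L k (cnj k) u v w" "?L k (cnj k) v w u" "?L k (cnj k) w u v"
    using nk(1) by auto
  have "x = k" if x: "?L x (cnj x) u v w" "?L x (cnj x) v w u"
  proof -
    define a b c a' b' c' where "a = 2 * u - v - w" "b = u * (2 * v * w - u * v - u * w)"
      "c = 2 * (u\<^sup>2 - v * w)" "a' = 2 * v - w - u" "b' = v * (2 * w * u - v * w - v * u)"
      "c' = 2 * (v\<^sup>2 - w * u)"
    note abc = this
    have "x * a - cnj x * b = c" "x * a' - cnj x * b' = c'" using x by (simp_all add: abc ac_simps)
    moreover have "x * (a * b' - a' * b) = (x * a - cnj x * b) * b' - (x * a' - cnj x * b') * b"
      by (simp add: algebra_simps)
    ultimately have "x * (a * b' - a' * b) = c * b' - c' * b" by simp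
    moreover have "a * b' - a' * b = (u - v) * n" unfolding abc n by algebra
    moreover have "c * b' - c' * b = (u - v) * (k * n)" unfolding abc nk(2) by algebra
    ultimately show ?thesis using ne(1) nk(1) by simp
  qed
  with kL show ?thesis
    unfolding cevian_equation[OF unit ne(2) nz(2)] cevian_equation[OF unit(2,3,1) ne(3) nz(3)]
      cevian_equation[OF unit(3,1,2) ne(1) nz(1)] k by blast
qed

section \<open>Poncelet closure and Blaschke products\<close>

(* Among these conics, those with k = 1 + \<beta>^2 - |\<alpha>|^2 are the ones that carry the vertices of
   triangles about the unit circle; their contact points solve a Blaschke equation with
   parameters \<alpha> and \<beta>. *)
definition poncelet_conic :: "real \<Rightarrow> complex \<Rightarrow> real \<Rightarrow> complex \<Rightarrow> real" where
  "poncelet_conic k \<alpha> \<beta> z = k * (cmod z)\<^sup>2 - 2 * \<beta> * Re (z\<^sup>2) + 4 * Re (cnj \<alpha> * z) - 4"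

lemma cmod_diff_square: "(cmod (x - y))\<^sup>2 = (cmod x)\<^sup>2 - 2 * Re (cnj x * y) + (cmod y)\<^sup>2"
  unfolding cmod_power2 by (simp add: algebra_simps power2_eq_square)

lemma cmod_one_minus_of_real_mult:
  "(cmod (1 - of_real \<beta> * z))\<^sup>2 = 1 - 2 * \<beta> * Re z + \<beta>\<^sup>2 * (cmod z)\<^sup>2"
  unfolding cmod_power2 by (simp add: algebra_simps power2_eq_square)

text \<open>With n = |v + w|^2 one has (v + w)^2 = n v w, so the vertex is (2 / n) (v + w) and its
  square is (4 / n) v w. Every term of the conic then carries the factor 4 / n.\<close>

lemma poncelet_conic_tangent_meet:
  assumes "cmod v = 1" "cmod w = 1" "v + w \<noteq> 0"
  shows "poncelet_conic k \<alpha> \<beta> (tangent_meet v w) = 0 \<longleftrightarrow>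
    k - 2 * \<beta> * Re (v * w) + 2 * Re (cnj \<alpha> * (v + w)) = (cmod (v + w))\<^sup>2"
proof -
  define n where "n = (cmod (v + w))\<^sup>2"
  note v0 = cnj_unit[OF assms(1)] and w0 = cnj_unit[OF assms(2)]
  have n: "n > 0" using assms(3) by (simp add: n_def)
  hence n4: "4 / n \<noteq> 0" by simp
  have nvw: "of_real n * (v * w) = (v + w)\<^sup>2"
    unfolding n_def complex_norm_square using v0 w0 by (simp add: field_simps power2_eq_square)
  have t: "tangent_meet v w = of_real (2 / n) * (v + w)"
  proof -
    have "tangent_meet v w = 2 * (of_real n * (v * w)) / (of_real n * (v + w))"
      using n by (simp add: tangent_meet_def)
    also have "\<dots> = 2 * (v + w) / of_real n"
      unfolding nvw using assms(3) by (simp add: power2_eq_square)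
    finally show ?thesis by simp
  qed
  have 1: "(cmod (tangent_meet v w))\<^sup>2 = 4 / n"
    unfolding t norm_mult power_mult_distrib n_def[symmetric] norm_of_real power2_abs
    using n by (simp add: power2_eq_square)
  have re: "Re (complex_of_real c * z) = c * Re z" for c z by simp
  have "(tangent_meet v w)\<^sup>2 = of_real (4 / n\<^sup>2) * (v + w)\<^sup>2"
    unfolding t power_mult_distrib by (simp add: power_divide)
  also have "\<dots> = of_real (4 / n) * (v * w)"
    unfolding nvw[symmetric] using n by (simp add: power2_eq_square)
  finally have 2: "Re ((tangent_meet v w)\<^sup>2) = 4 / n * Re (v * w)" by (simp only: re)
  have "cnj \<alpha> * tangent_meet v w = of_real (2 / n) * (cnj \<alpha> * (v + w))"
    unfolding t by (simp only: ac_simps)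
  hence 3: "Re (cnj \<alpha> * tangent_meet v w) = 2 / n * Re (cnj \<alpha> * (v + w))"
    by (simp only: re)
  have "poncelet_conic k \<alpha> \<beta> (tangent_meet v w)
      = 4 / n * (k - 2 * \<beta> * Re (v * w) + 2 * Re (cnj \<alpha> * (v + w)) - n)"
    unfolding poncelet_conic_def 1 2 3 using n by (simp add: field_simps)
  also have "\<dots> = 0 \<longleftrightarrow> k - 2 * \<beta> * Re (v * w) + 2 * Re (cnj \<alpha> * (v + w)) = n"
    using n4 by (simp only: mult_eq_0_iff right_minus_eq simp_thms)
  finally show ?thesis by (simp only: n_def)
qed

text \<open>\<alpha> - (v + w) = u (1 - \<beta> v w); on taking squared moduli, u drops out.\<close>

lemma poncelet_chord_identity:
  assumes "cmod u = 1" "cmod v = 1" "cmod w = 1" "\<alpha> = u + v + w - u * v * w * of_real \<beta>"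
  shows "1 + \<beta>\<^sup>2 - (cmod \<alpha>)\<^sup>2 - 2 * \<beta> * Re (v * w) + 2 * Re (cnj \<alpha> * (v + w)) = (cmod (v + w))\<^sup>2"
proof -
  have "\<alpha> - (v + w) = u * (1 - of_real \<beta> * (v * w))"
    unfolding assms(4) by (simp add: algebra_simps)
  hence "(cmod (\<alpha> - (v + w)))\<^sup>2 = (cmod (u * (1 - of_real \<beta> * (v * w))))\<^sup>2" by simp
  also have "\<dots> = 1 - 2 * \<beta> * Re (v * w) + \<beta>\<^sup>2"
    unfolding norm_mult power_mult_distrib cmod_one_minus_of_real_mult using assms(1-3) by (simp add: norm_mult)
  finally show ?thesis unfolding cmod_diff_square by simp
qed

(* Two conics of this shape with the same \<beta> that share the three vertices differ by
   const + 2 Re (cnj \<gamma> (v + w)) at the vertex on the tangents at v and w. Vanishing for all three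
   pairs would put u, v, w on one line unless \<gamma> = 0. *)
lemma poncelet_closure:
  assumes unit: "cmod u = 1" "cmod v = 1" "cmod w = 1" and ne: "u \<noteq> v" "v \<noteq> w" "w \<noteq> u"
    and nz: "u + v \<noteq> 0" "v + w \<noteq> 0" "w + u \<noteq> 0"
    and "poncelet_conic k \<alpha> \<beta> (tangent_meet v w) = 0" "poncelet_conic k \<alpha> \<beta> (tangent_meet w u) = 0"
      "poncelet_conic k \<alpha> \<beta> (tangent_meet u v) = 0"
  shows "u + v + w = \<alpha> + u * v * w * of_real \<beta>" "k = 1 + \<beta>\<^sup>2 - (cmod \<alpha>)\<^sup>2"
proof -
  \<comment> \<open>The parameter dictated by the contact points themselves: by the chord identity
    its conic passes through the same three vertices.\<close>
  define \<alpha>' where "\<alpha>' = u + v + w - u * v * w * of_real \<beta>"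
  define \<gamma> where "\<gamma> = \<alpha> - \<alpha>'"
  note chord = poncelet_conic_tangent_meet[THEN iffD1]
  have "k - 2 * \<beta> * Re (v * w) + 2 * Re (cnj \<alpha> * (v + w)) = (cmod (v + w))\<^sup>2"
    "k - 2 * \<beta> * Re (w * u) + 2 * Re (cnj \<alpha> * (w + u)) = (cmod (w + u))\<^sup>2"
    "k - 2 * \<beta> * Re (u * v) + 2 * Re (cnj \<alpha> * (u + v)) = (cmod (u + v))\<^sup>2"
    using chord[OF unit(2,3) nz(2)] chord[OF unit(3,1) nz(3)] chord[OF unit(1,2) nz(1)] assms(10-12) by auto
  moreover have "\<alpha>' = v + w + u - v * w * u * of_real \<beta>" "\<alpha>' = w + u + v - w * u * v * of_real \<beta>"
    unfolding \<alpha>'_def by (simp_all only: ac_simps)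
  hence "1 + \<beta>\<^sup>2 - (cmod \<alpha>')\<^sup>2 - 2 * \<beta> * Re (v * w) + 2 * Re (cnj \<alpha>' * (v + w)) = (cmod (v + w))\<^sup>2"
    "1 + \<beta>\<^sup>2 - (cmod \<alpha>')\<^sup>2 - 2 * \<beta> * Re (w * u) + 2 * Re (cnj \<alpha>' * (w + u)) = (cmod (w + u))\<^sup>2"
    "1 + \<beta>\<^sup>2 - (cmod \<alpha>')\<^sup>2 - 2 * \<beta> * Re (u * v) + 2 * Re (cnj \<alpha>' * (u + v)) = (cmod (u + v))\<^sup>2"
    using poncelet_chord_identity[OF unit \<alpha>'_def] poncelet_chord_identity[OF unit(2,3,1)]
      poncelet_chord_identity[OF unit(3,1,2)] by blast+
  moreover have "k - (1 + \<beta>\<^sup>2 - (cmod \<alpha>')\<^sup>2) + 2 * Re (cnj \<gamma> * z) = 0"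
    if "k - q + 2 * Re (cnj \<alpha> * z) = n" "1 + \<beta>\<^sup>2 - (cmod \<alpha>')\<^sup>2 - q + 2 * Re (cnj \<alpha>' * z) = n" for z q n
  proof -
    have "Re (cnj \<gamma> * z) = Re (cnj \<alpha> * z) - Re (cnj \<alpha>' * z)"
      by (simp add: \<gamma>_def algebra_simps)
    thus ?thesis using that by linarith
  qed
  ultimately have E: "k - (1 + \<beta>\<^sup>2 - (cmod \<alpha>')\<^sup>2) + 2 * Re (cnj \<gamma> * (v + w)) = 0"
    "k - (1 + \<beta>\<^sup>2 - (cmod \<alpha>')\<^sup>2) + 2 * Re (cnj \<gamma> * (w + u)) = 0"
    "k - (1 + \<beta>\<^sup>2 - (cmod \<alpha>')\<^sup>2) + 2 * Re (cnj \<gamma> * (u + v)) = 0"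
    by blast+
  \<comment> \<open>Equal real parts say that \<gamma> is orthogonal to the chord x y, which for
    unit numbers is this equation. Two chords sharing the end v then force \<gamma> = 0.\<close>
  have G: "\<gamma> = cnj \<gamma> * (x * y)"
    if "cmod x = 1" "cmod y = 1" "x \<noteq> y" "Re (cnj \<gamma> * x) = Re (cnj \<gamma> * y)" for x y
  proof -
    note x0 = cnj_unit[OF that(1)] and y0 = cnj_unit[OF that(2)]
    have "cnj \<gamma> * x + \<gamma> * (1 / x) = cnj \<gamma> * y + \<gamma> * (1 / y)"
      using that(4) complex_add_cnj[of "cnj \<gamma> * x"] complex_add_cnj[of "cnj \<gamma> * y"] x0 y0 by simp
    hence "(x - y) * (cnj \<gamma> * (x * y) - \<gamma>) = 0" using x0 y0 by (simp add: field_simps)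
    thus ?thesis using that(3) by simp
  qed
  have "\<gamma> = cnj \<gamma> * (u * v)" "\<gamma> = cnj \<gamma> * (v * w)"
    using E unit ne by (intro G; simp add: distrib_left)+
  hence "cnj \<gamma> * (v * (u - w)) = 0" by (simp add: algebra_simps)
  hence "\<gamma> = 0" using ne cnj_unit(2)[OF unit(2)] by simp
  hence a: "\<alpha>' = \<alpha>" by (simp add: \<gamma>_def)
  thus "u + v + w = \<alpha> + u * v * w * of_real \<beta>" by (simp add: \<alpha>'_def algebra_simps)
  show "k = 1 + \<beta>\<^sup>2 - (cmod \<alpha>)\<^sup>2" using E(1) \<open>\<gamma> = 0\<close> a by simp
qed

lemma poncelet_conic_vertex:
  assumes unit: "cmod u = 1" "cmod v = 1" "cmod w = 1" and nz: "v + w \<noteq> 0"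
    and "u + v + w = \<alpha> + u * v * w * of_real \<beta>" "k = 1 + \<beta>\<^sup>2 - (cmod \<alpha>)\<^sup>2"
  shows "poncelet_conic k \<alpha> \<beta> (tangent_meet v w) = 0"
proof -
  have "\<alpha> = u + v + w - u * v * w * of_real \<beta>" using assms(5) by simp
  thus ?thesis
    using poncelet_chord_identity[OF unit, of \<alpha> \<beta>] assms(6)
    unfolding poncelet_conic_tangent_meet[OF unit(2,3) nz] by simp
qed

text \<open>For the value of k that permits closure, the sign of the conic compares two moduli;
  nestedness is tested in this form.\<close>

lemma poncelet_conic_eq:
  "poncelet_conic (1 + \<beta>\<^sup>2 - (cmod \<alpha>)\<^sup>2) \<alpha> \<beta> z
    = (cmod (z - of_real \<beta> * cnj z))\<^sup>2 - (cmod (2 - cnj \<alpha> * z))\<^sup>2"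
  unfolding poncelet_conic_def cmod_power2 by (simp add: algebra_simps power2_eq_square)

text \<open>On the unit circle the first modulus is at most 1 + \<beta> and the second at least 2 -
  \<beta>.\<close>

lemma poncelet_conic_unit_neg:
  assumes "cmod \<alpha> \<le> \<beta>" "\<beta> < 1/2" "cmod z = 1"
  shows "poncelet_conic (1 + \<beta>\<^sup>2 - (cmod \<alpha>)\<^sup>2) \<alpha> \<beta> z < 0"
proof -
  have b: "0 \<le> \<beta>" using assms(1) norm_ge_zero order_trans by blast
  have "cmod (z - of_real \<beta> * cnj z) \<le> 1 + \<beta>"
    using norm_triangle_ineq4[of z "of_real \<beta> * cnj z"] assms(3) b by (simp add: norm_mult)
  moreover have "2 - \<beta> \<le> cmod (2 - cnj \<alpha> * z)"
    using norm_triangle_ineq2[of 2 "cnj \<alpha> * z"] assms(1,3) by (simp add: norm_mult)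
  ultimately have "cmod (z - of_real \<beta> * cnj z) < cmod (2 - cnj \<alpha> * z)" using assms(2) by linarith
  thus ?thesis unfolding poncelet_conic_eq by (simp add: power_strict_mono)
qed

section \<open>Unit roots of the Blaschke equation\<close>

lemma complex_cubic_roots:
  fixes s m l :: complex
  obtains u v w where "u + v + w = s" "u * v + v * w + w * u = m" "u * v * w = l"
proof -
  have "\<not> constant (poly [:- l, m, - s, 1:])"
    unfolding constant_degree by simp
  then obtain u where "poly [:- l, m, - s, 1:] u = 0"
    using fundamental_theorem_of_algebra by blast
  hence u: "u * (u * (u - s) + m) = l" by (simp add: algebra_simps)
  \<comment> \<open>A square root of the discriminant of the quadratic left after dividing the cubic
    by z - u.\<close>
  define d where "d = csqrt ((s - u)\<^sup>2 - 4 * (u\<^sup>2 - s * u + m))"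
  have d: "d\<^sup>2 = (s - u)\<^sup>2 - 4 * (u\<^sup>2 - s * u + m)" by (simp add: d_def)
  define v w where vw: "v = (s - u + d) / 2" "w = (s - u - d) / 2"
  have sum: "v + w = s - u" by (simp add: vw add_divide_distrib[symmetric])
  have "2 * v = s - u + d" "2 * w = s - u - d" by (simp_all add: vw)
  moreover have "4 * (v * w) = (2 * v) * (2 * w)" by simp
  ultimately have "4 * (v * w) = (s - u + d) * (s - u - d)" by simp
  also have "\<dots> = (s - u)\<^sup>2 - d\<^sup>2" by (simp add: algebra_simps power2_eq_square)
  finally have "4 * (v * w) = (s - u)\<^sup>2 - d\<^sup>2" .
  hence "4 * (v * w) = 4 * (u\<^sup>2 - s * u + m)" unfolding d by simp
  hence prod: "v * w = u\<^sup>2 - s * u + m" by (subst (asm) mult_cancel_left) simp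
  show ?thesis
  proof (rule that[of u v w])
    show "u + v + w = s" using sum by (simp add: add.assoc)
    have "u * v + v * w + w * u = u * (v + w) + v * w" by (simp add: algebra_simps)
    thus "u * v + v * w + w * u = m" unfolding sum prod by (simp add: algebra_simps power2_eq_square)
    have "u * v * w = u * (v * w)" by (simp add: mult.assoc)
    thus "u * v * w = l" unfolding prod using u by (simp add: algebra_simps power2_eq_square)
  qed
qed

(* Write the equation as z q(z) = l q*(z) with q(z) = z^2 - \<alpha> z + \<beta> and q* its reciprocal
   polynomial: the Blaschke product z q / q* has modulus 1 only on the unit circle. *)
lemma blaschke_root_unit:
  assumes "cmod l = 1" "cmod \<alpha> \<le> \<beta>" "\<beta> < 1/2"
    and "z * (z\<^sup>2 - \<alpha> * z + of_real \<beta>) = l * (1 - cnj \<alpha> * z + of_real \<beta> * z\<^sup>2)"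
  shows "cmod z = 1"
proof -
  define \<rho> where "\<rho> = (cmod z)\<^sup>2"
  define q q' where "q = (cmod (z\<^sup>2 - \<alpha> * z + of_real \<beta>))\<^sup>2"
    and "q' = (cmod (1 - cnj \<alpha> * z + of_real \<beta> * z\<^sup>2))\<^sup>2"
  have b: "0 \<le> \<beta>" using assms(2) norm_ge_zero order_trans by blast
  have eq: "\<rho> * q = q'"
  proof -
    have "(cmod (z * (z\<^sup>2 - \<alpha> * z + of_real \<beta>)))\<^sup>2 = (cmod (l * (1 - cnj \<alpha> * z + of_real \<beta> * z\<^sup>2)))\<^sup>2"
      unfolding assms(4) ..
    thus ?thesis using assms(1) by (simp add: norm_mult power_mult_distrib \<rho>_def q_def q'_def)
  qed
  \<comment> \<open>The cofactor of 1 - \<rho> in q' - q. Together with \<rho> q = q' it gives (1 -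
    \<rho>) (K + q) = 0, so positivity of K suffices.\<close>
  define K where "K = (1 + \<rho>) * (1 - \<beta>\<^sup>2) - 2 * Re (cnj \<alpha> * z) + 2 * \<beta> * Re (\<alpha> * z)"
  have diff: "q' - q = (1 - \<rho>) * K"
    unfolding q_def q'_def \<rho>_def K_def cmod_power2 by (simp add: power2_eq_square) algebra
  \<comment> \<open>From |\<alpha>| \<le> \<beta> and 2 |z| \<le> 1 + \<rho>, K is at least (1 +
    \<rho>) (1 + \<beta>) (1 - 2 \<beta>).\<close>
  have "K > 0"
  proof -
    have *: "cmod \<alpha> * cmod z \<le> \<beta> * cmod z" using assms(2) by (simp add: mult_right_mono)
    have z: "2 * cmod z \<le> 1 + \<rho>"
      using zero_le_power2[of "cmod z - 1"] by (simp add: \<rho>_def power2_eq_square algebra_simps)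
    have "Re (cnj \<alpha> * z) \<le> \<beta> * cmod z"
      using complex_Re_le_cmod[of "cnj \<alpha> * z"] * by (simp add: norm_mult)
    moreover have "- (\<beta> * cmod z) \<le> Re (\<alpha> * z)"
      using abs_Re_le_cmod[of "\<alpha> * z"] * by (simp add: norm_mult)
    hence "\<beta> * (- (\<beta> * cmod z)) \<le> \<beta> * Re (\<alpha> * z)" using b by (rule mult_left_mono)
    ultimately have "K \<ge> (1 + \<rho>) * (1 - \<beta>\<^sup>2) - \<beta> * (1 + \<beta>) * (2 * cmod z)"
      by (simp add: K_def algebra_simps)
    moreover have "\<beta> * (1 + \<beta>) * (2 * cmod z) \<le> \<beta> * (1 + \<beta>) * (1 + \<rho>)"
      using z b by (intro mult_left_mono) auto
    moreover have "(1 + \<rho>) * (1 - \<beta>\<^sup>2) - \<beta> * (1 + \<beta>) * (1 + \<rho>) = (1 + \<rho>) * ((1 + \<beta>) * (1 - 2 * \<beta>))"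
      by (simp add: algebra_simps power2_eq_square)
    moreover have "(1 + \<rho>) * ((1 + \<beta>) * (1 - 2 * \<beta>)) > 0"
      using b assms(3) by (intro mult_pos_pos) (auto simp: \<rho>_def add_pos_nonneg)
    ultimately show ?thesis by linarith
  qed
  have "(1 - \<rho>) * (K + q) = 0" using diff eq by (simp add: algebra_simps)
  moreover have "q \<ge> 0" by (simp add: q_def)
  ultimately have "\<rho> = 1" using \<open>K > 0\<close> by auto
  thus ?thesis using norm_ge_zero[of z] by (auto simp: \<rho>_def power2_eq_1_iff)
qed

lemma blaschke_roots:
  assumes l: "cmod l = 1" and \<alpha>: "cmod \<alpha> \<le> \<beta>" and \<beta>: "\<beta> < 1/2"
  obtains u v w where "cmod u = 1" "cmod v = 1" "cmod w = 1" "u \<noteq> v" "v \<noteq> w" "w \<noteq> u"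
    "u * v * w = l" "u + v + w = \<alpha> + l * of_real \<beta>"
proof -
  obtain u v w where s: "u + v + w = \<alpha> + l * of_real \<beta>"
    \<comment> \<open>The value l * cnj s, with s the prescribed sum, that
      \<open>cnj_sum_unit\<close> imposes on unit roots.\<close>
    and m: "u * v + v * w + w * u = of_real \<beta> + l * cnj \<alpha>" and p: "u * v * w = l"
    using complex_cubic_roots by blast
  have b: "0 \<le> \<beta>" using \<alpha> norm_ge_zero order_trans by blast
  have unit: "cmod z = 1" if "(z - u) * (z - v) * (z - w) = 0" for z
  proof (rule blaschke_root_unit[OF l \<alpha> \<beta>])
    have "z * (z\<^sup>2 - \<alpha> * z + of_real \<beta>) - l * (1 - cnj \<alpha> * z + of_real \<beta> * z\<^sup>2)
        = z^3 - (\<alpha> + l * of_real \<beta>) * z\<^sup>2 + (of_real \<beta> + l * cnj \<alpha>) * z - l"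
      by (simp add: algebra_simps power2_eq_square power3_eq_cube)
    also have "\<dots> = z^3 - (u + v + w) * z\<^sup>2 + (u * v + v * w + w * u) * z - u * v * w"
      by (simp only: s m p)
    also have "\<dots> = (z - u) * (z - v) * (z - w)"
      by (simp add: algebra_simps power2_eq_square power3_eq_cube)
    finally show "z * (z\<^sup>2 - \<alpha> * z + of_real \<beta>) = l * (1 - cnj \<alpha> * z + of_real \<beta> * z\<^sup>2)"
      using that by simp
  qed
  hence U: "cmod u = 1" "cmod v = 1" "cmod w = 1" by auto
  \<comment> \<open>A double root v would give |2 v - \<alpha>| = |1 - \<beta> v^2|, but the left
    side is at least 2 - \<beta> and the right side at most 1 + \<beta>.\<close>
  have ne: "v \<noteq> w" if "u + v + w = \<alpha> + l * of_real \<beta>" "u * v * w = l" "cmod u = 1" "cmod v = 1" for u v w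
  proof
    assume "v = w"
    hence "2 * v - \<alpha> = - (u * (1 - of_real \<beta> * v\<^sup>2))"
      using that(1,2) by (simp add: algebra_simps power2_eq_square)
    hence "cmod (2 * v - \<alpha>) = cmod (1 - of_real \<beta> * v\<^sup>2)"
      using that(3) by (simp add: norm_mult)
    moreover have "cmod (1 - of_real \<beta> * v\<^sup>2) \<le> 1 + \<beta>"
      using norm_triangle_ineq4[of 1 "of_real \<beta> * v\<^sup>2"] that(4) b by (simp add: norm_mult norm_power)
    moreover have "2 - \<beta> \<le> cmod (2 * v - \<alpha>)"
      using norm_triangle_ineq2[of "2 * v" \<alpha>] that(4) \<alpha> by (simp add: norm_mult)
    ultimately show False using \<beta> by linarith
  qed
  show ?thesis
    using that[of u v w] U s p ne[of u v w] ne[of v w u] ne[of w u v] by (auto simp: ac_simps)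
qed

section \<open>The locus in normalised coordinates\<close>

lemma gergonne_touch_coordinates:
  assumes "is_incircle C r P Q R" "is_gergonne_point P Q R X"
  obtains u v w where "cmod u = 1" "cmod v = 1" "cmod w = 1" "u \<noteq> v" "v \<noteq> w" "w \<noteq> u"
    "u + v \<noteq> 0" "v + w \<noteq> 0" "w + u \<noteq> 0"
    "P = C + of_real r * tangent_meet v w" "Q = C + of_real r * tangent_meet w u"
    "R = C + of_real r * tangent_meet u v"
    "X \<in> affine hull {P, C + of_real r * u}" "X \<in> affine hull {Q, C + of_real r * v}"
    "X \<in> affine hull {R, C + of_real r * w}"
proof -
  obtain D E F where t: "touches_side C r Q R D" "touches_side C r R P E" "touches_side C r P Q F"
    and nd: "\<not> collinear {P, Q, R}" and r: "0 < r"
    using assms(1) unfolding is_incircle_def nondegenerate_triangle_def by blast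
  obtain I r' D' E' F' where t': "touches_side I r' Q R D'" "touches_side I r' R P E'" "touches_side I r' P Q F'"
    and X: "X \<in> affine hull {P, D'}" "X \<in> affine hull {Q, E'}" "X \<in> affine hull {R, F'}"
    using assms(2) unfolding is_gergonne_point_def by blast
  have "D = D'" "E = E'" "F = F'"
    using touch_point_unique[OF t t'] touch_point_unique[OF t(2,3,1) t'(2,3,1)]
      touch_point_unique[OF t(3,1,2) t'(3,1,2)] by auto
  with X have X: "X \<in> affine hull {P, D}" "X \<in> affine hull {Q, E}" "X \<in> affine hull {R, F}"
    by simp_all
  show ?thesis
  proof (rule touch_coordinates[OF nd r t])
    fix u v w
    assume uvw: "cmod u = 1" "cmod v = 1" "cmod w = 1" "u \<noteq> v" "v \<noteq> w" "w \<noteq> u"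
      "u + v \<noteq> 0" "v + w \<noteq> 0" "w + u \<noteq> 0"
      and DEF: "D = C + of_real r * u" "E = C + of_real r * v" "F = C + of_real r * w"
      and PQR: "P = C + of_real r * tangent_meet v w" "Q = C + of_real r * tangent_meet w u"
        "R = C + of_real r * tangent_meet u v"
    show ?thesis by (rule that[OF uvw PQR X[unfolded DEF]])
  qed
qed

text \<open>The last fact is conditional because the bound on |u + v + w| is supplied later, from
  the closure relation.\<close>

lemma gergonne_point_coord:
  assumes "is_incircle C r P Q R" "is_gergonne_point P Q R X"
  obtains u v w where "cmod u = 1" "cmod v = 1" "cmod w = 1" "u \<noteq> v" "v \<noteq> w" "w \<noteq> u"
    "u + v \<noteq> 0" "v + w \<noteq> 0" "w + u \<noteq> 0"
    "P = C + of_real r * tangent_meet v w" "Q = C + of_real r * tangent_meet w u"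
    "R = C + of_real r * tangent_meet u v"
    "cmod (u + v + w) < 3 \<Longrightarrow> X = C + of_real r * gergonne_coord (u * v * w) (u + v + w)"
proof -
  from assms(1) have r: "r > 0" by (simp add: is_incircle_def)
  obtain u v w where uvw: "cmod u = 1" "cmod v = 1" "cmod w = 1" "u \<noteq> v" "v \<noteq> w" "w \<noteq> u"
    "u + v \<noteq> 0" "v + w \<noteq> 0" "w + u \<noteq> 0"
    "P = C + of_real r * tangent_meet v w" "Q = C + of_real r * tangent_meet w u"
    "R = C + of_real r * tangent_meet u v"
    "X \<in> affine hull {P, C + of_real r * u}" "X \<in> affine hull {Q, C + of_real r * v}"
    "X \<in> affine hull {R, C + of_real r * w}"
    using gergonne_touch_coordinates[OF assms] by blast
  define x where "x = (X - C) / of_real r"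
  have X: "X = C + of_real r * x" using r by (simp add: x_def)
  have "X = C + of_real r * gergonne_coord (u * v * w) (u + v + w)" if "cmod (u + v + w) < 3"
    using uvw(13-15) cevians_concurrent_iff[OF uvw(1-9) that, of x] r
    unfolding uvw(10-12) X by (simp add: affine_hull_pair_similar)
  thus ?thesis by (rule that[OF uvw(1-12)])
qed

lemma gergonne_pointI:
  assumes "0 < r" "cmod u = 1" "cmod v = 1" "cmod w = 1" "cmod (u + v + w) < 1"
    and "u \<noteq> v" "v \<noteq> w" "w \<noteq> u"
  shows "is_gergonne_point (C + of_real r * tangent_meet v w) (C + of_real r * tangent_meet w u)
    (C + of_real r * tangent_meet u v) (C + of_real r * gergonne_coord (u * v * w) (u + v + w))"
proof -
  have nz: "u + v \<noteq> 0" "v + w \<noteq> 0" "w + u \<noteq> 0"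
    using unit_sum_nonzero[of w u v] unit_sum_nonzero[of u v w] unit_sum_nonzero[of v w u] assms(2-5)
    by (auto simp: ac_simps)
  note inc = is_incircle_tangent_meet[OF assms(1-6), of C]
  have "cmod (u + v + w) < 3" using assms(5) by simp
  from cevians_concurrent_iff[OF assms(2-4,6-8) nz this, THEN iffD2, OF refl] assms(1) inc
  show ?thesis unfolding is_gergonne_point_def
    by (intro exI[of _ C] exI[of _ r] exI[of _ "C + of_real r * u"] exI[of _ "C + of_real r * v"]
        exI[of _ "C + of_real r * w"]) (simp add: affine_hull_pair_similar)
qed

text \<open>For \<alpha> = \<beta> \<tau> and l = \<tau> \<mu> the sum is s = \<beta> \<tau> (1 +
  \<mu>), and l (cnj s)^2 = 2 \<beta>^2 (1 + Re \<mu>) cnj \<tau>. The fixed direction \<tau> thus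
  separates from the parameter \<mu>.\<close>

lemma gergonne_coord_polar:
  fixes \<beta> :: real
  assumes \<tau>: "cmod \<tau> = 1" and \<mu>: "cmod \<mu> = 1"
  defines "d \<equiv> 9 - 2 * \<beta>\<^sup>2 * (1 + Re \<mu>)"
  shows "gergonne_coord (\<tau> * \<mu>) (of_real \<beta> * \<tau> + \<tau> * \<mu> * of_real \<beta>) =
    Complex (2 * \<beta> * (3 - 2 * \<beta>) * Re \<tau> * ((1 + Re \<mu>) / d) - 6 * \<beta> * Im \<tau> * (Im \<mu> / d))
      (2 * \<beta> * (3 + 2 * \<beta>) * Im \<tau> * ((1 + Re \<mu>) / d) + 6 * \<beta> * Re \<tau> * (Im \<mu> / d))"
proof -
  define s where "s = of_real \<beta> * \<tau> * (1 + \<mu>)"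
  have s: "of_real \<beta> * \<tau> + \<tau> * \<mu> * of_real \<beta> = s" by (simp add: s_def algebra_simps)
  have m: "(cmod (1 + \<mu>))\<^sup>2 = 2 * (1 + Re \<mu>)"
  proof -
    have "(Re \<mu>)\<^sup>2 + (Im \<mu>)\<^sup>2 = 1" using \<mu> cmod_power2[of \<mu>] by simp
    thus ?thesis unfolding cmod_power2 by (simp add: algebra_simps power2_eq_square)
  qed
  have d: "9 - (cmod s)\<^sup>2 = d"
    unfolding s_def norm_mult power_mult_distrib m using \<tau> by (simp add: d_def)
  have t1: "\<tau> * cnj \<tau> = 1" and m1: "\<mu> * cnj \<mu> = 1"
    using \<tau> \<mu> by (simp_all flip: complex_norm_square)
  have "\<tau> * \<mu> * (cnj s)\<^sup>2 = of_real (\<beta>\<^sup>2) * cnj \<tau> * (\<tau> * cnj \<tau>) * (\<mu> + 2 * (\<mu> * cnj \<mu>) + (\<mu> * cnj \<mu>) * cnj \<mu>)"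
    by (simp add: s_def algebra_simps power2_eq_square)
  also have "\<dots> = of_real (\<beta>\<^sup>2) * cnj \<tau> * (2 + (\<mu> + cnj \<mu>))"
    unfolding t1 m1 by (simp add: algebra_simps)
  finally have q: "\<tau> * \<mu> * (cnj s)\<^sup>2 = of_real (2 * \<beta>\<^sup>2 * (1 + Re \<mu>)) * cnj \<tau>"
    unfolding complex_add_cnj by (simp add: algebra_simps)
  have "gergonne_coord (\<tau> * \<mu>) s = (6 * s - 2 * (\<tau> * \<mu> * (cnj s)\<^sup>2)) / of_real (9 - (cmod s)\<^sup>2)"
    by (simp add: gergonne_coord_def mult.assoc)
  also have "\<dots> = (6 * s - 2 * (of_real (2 * \<beta>\<^sup>2 * (1 + Re \<mu>)) * cnj \<tau>)) / of_real d"
    unfolding q d ..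
  finally have g: "gergonne_coord (\<tau> * \<mu>) s = \<dots>" .
  show ?thesis unfolding s g unfolding s_def
    by (simp add: complex_eq_iff add_divide_distrib diff_divide_distrib algebra_simps power2_eq_square)
qed

(* The locus is parametrised by p = (1 + cos t) / d and q = sin t / d; the identity says that the
   quadratic form of the (p, q)-ellipse pulls back to an axis-parallel one. *)
lemma rotated_ellipse_identity:
  fixes e f x y p q \<beta> :: real
  assumes "e > 0" "f > 0"
  shows "(2 * \<beta> * e * x * p - 6 * \<beta> * y * q)\<^sup>2 / e + (2 * \<beta> * f * y * p + 6 * \<beta> * x * q)\<^sup>2 / f
    = 36 * \<beta>\<^sup>2 * (x\<^sup>2 / f + y\<^sup>2 / e) * (e * f / 9 * p\<^sup>2 + q\<^sup>2)"
proof -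
  have 1: "(2 * \<beta> * e * x * p - 6 * \<beta> * y * q)\<^sup>2 / e
      = 4 * \<beta>\<^sup>2 * e * x\<^sup>2 * p\<^sup>2 - 24 * \<beta>\<^sup>2 * x * y * p * q + 36 * \<beta>\<^sup>2 * q\<^sup>2 * (y\<^sup>2 / e)"
    using assms(1) by (simp add: field_simps power2_eq_square)
  have 2: "(2 * \<beta> * f * y * p + 6 * \<beta> * x * q)\<^sup>2 / f
      = 4 * \<beta>\<^sup>2 * f * y\<^sup>2 * p\<^sup>2 + 24 * \<beta>\<^sup>2 * x * y * p * q + 36 * \<beta>\<^sup>2 * q\<^sup>2 * (x\<^sup>2 / f)"
    using assms(2) by (simp add: field_simps power2_eq_square)
  have "e * f * (x\<^sup>2 / f + y\<^sup>2 / e) = e * x\<^sup>2 + f * y\<^sup>2"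
    using assms by (simp add: distrib_left)
  hence 3: "36 * \<beta>\<^sup>2 * (x\<^sup>2 / f + y\<^sup>2 / e) * (e * f / 9 * p\<^sup>2)
      = 4 * \<beta>\<^sup>2 * p\<^sup>2 * (e * x\<^sup>2 + f * y\<^sup>2)" by simp
  show ?thesis unfolding 1 2 distrib_left[of "36 * \<beta>\<^sup>2 * (x\<^sup>2 / f + y\<^sup>2 / e)"] 3
    by (simp add: algebra_simps)
qed

lemma rational_circle_point:
  fixes \<beta> p q :: real
  assumes "(9 - 4 * \<beta>\<^sup>2) / 9 * p\<^sup>2 + q\<^sup>2 = 2 * p / 9" "\<beta>\<^sup>2 < 1"
  obtains \<mu> where "cmod \<mu> = 1" "p = (1 + Re \<mu>) / (9 - 2 * \<beta>\<^sup>2 * (1 + Re \<mu>))"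
    "q = Im \<mu> / (9 - 2 * \<beta>\<^sup>2 * (1 + Re \<mu>))"
proof -
  have "0 \<le> (9 - 4 * \<beta>\<^sup>2) / 9 * p\<^sup>2 + q\<^sup>2" using assms(2) by (intro add_nonneg_nonneg mult_nonneg_nonneg) auto
  hence p: "p \<ge> 0" using assms(1) by simp
  hence k: "1 + 2 * \<beta>\<^sup>2 * p > 0" by (simp add: add_pos_nonneg)
  \<comment> \<open>Solves d = 9 - 2 \<beta>^2 (1 + Re \<mu>) under the substitution 1 + Re \<mu> =
    d p.\<close>
  define d where "d = 9 / (1 + 2 * \<beta>\<^sup>2 * p)"
  have d0: "d > 0" using k by (simp add: d_def)
  have d: "d * (1 + 2 * \<beta>\<^sup>2 * p) = 9"
    using k nonzero_eq_divide_eq[of "1 + 2 * \<beta>\<^sup>2 * p" d 9] by (simp add: d_def)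
  define \<mu> where "\<mu> = Complex (d * p - 1) (d * q)"
  have d': "9 - 2 * \<beta>\<^sup>2 * (1 + Re \<mu>) = d" using d by (simp add: \<mu>_def algebra_simps)
  have "d\<^sup>2 * (p\<^sup>2 + q\<^sup>2) - 2 * (d * p) = d\<^sup>2 * ((9 - 4 * \<beta>\<^sup>2) / 9 * p\<^sup>2 + q\<^sup>2 - 2 * p / 9)"
  proof -
    have "d\<^sup>2 * (p + 2 * \<beta>\<^sup>2 * p\<^sup>2) = (d * (1 + 2 * \<beta>\<^sup>2 * p)) * (d * p)"
      by (simp add: algebra_simps power2_eq_square)
    hence h: "2 * (d * p) = 2 / 9 * (d\<^sup>2 * (p + 2 * \<beta>\<^sup>2 * p\<^sup>2))" unfolding d by simp
    show ?thesis unfolding h by (simp add: field_simps power2_eq_square)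
  qed
  also have "\<dots> = 0" using assms(1) by simp
  finally have "(d * p - 1)\<^sup>2 + (d * q)\<^sup>2 = 1" by (simp add: algebra_simps power2_eq_square)
  hence "cmod \<mu> = 1" by (simp add: \<mu>_def cmod_def)
  moreover have "p = (1 + Re \<mu>) / d" "q = Im \<mu> / d" using d0 by (simp_all add: \<mu>_def)
  ultimately show ?thesis by (rule that[of \<mu>, unfolded d'])
qed

lemma circle_point_rational:
  fixes \<beta> :: real
  assumes "cmod \<mu> = 1" "\<beta>\<^sup>2 < 1"
  defines "d \<equiv> 9 - 2 * \<beta>\<^sup>2 * (1 + Re \<mu>)"
  shows "(9 - 4 * \<beta>\<^sup>2) / 9 * ((1 + Re \<mu>) / d)\<^sup>2 + (Im \<mu> / d)\<^sup>2 = 2 * ((1 + Re \<mu>) / d) / 9"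
proof -
  have "Re \<mu> \<le> 1" using complex_Re_le_cmod[of \<mu>] assms(1) by simp
  hence "\<beta>\<^sup>2 * (1 + Re \<mu>) \<le> 1 * 2"
    using assms(2) abs_Re_le_cmod[of \<mu>] assms(1) by (intro mult_mono) auto
  hence d0: "d > 0" by (simp add: d_def)
  have "(Re \<mu>)\<^sup>2 + (Im \<mu>)\<^sup>2 = 1" using assms(1) cmod_power2[of \<mu>] by simp
  hence im: "(Im \<mu>)\<^sup>2 = 1 - (Re \<mu>)\<^sup>2" by simp
  have "(9 - 4 * \<beta>\<^sup>2) / 9 * (1 + Re \<mu>)\<^sup>2 + (Im \<mu>)\<^sup>2 = 2 * (1 + Re \<mu>) / 9 * d"
    unfolding im d_def by (simp add: field_simps power2_eq_square)
  thus ?thesis using d0 by (simp add: field_simps power2_eq_square)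
qed

text \<open>The pair (p, q) runs over a fixed ellipse and is mapped to the plane linearly. By
  \<open>rotated_ellipse_identity\<close> the image is axis-parallel for every \<tau>; \<tau>
  affects only its centre and the common scale \<open>m\<close>.\<close>

lemma gergonne_coord_locus:
  assumes \<tau>: "cmod \<tau> = 1" and \<beta>: "0 < \<beta>" "\<beta> < 1/2"
  obtains p m where "m > 0"
    "{gergonne_coord l (of_real \<beta> * \<tau> + l * of_real \<beta>) | l. cmod l = 1}
      = axis_ellipse p (sqrt (3 - 2 * \<beta>) * m) (sqrt (3 + 2 * \<beta>) * m)"
proof -
  define e f where ef: "e = 3 - 2 * \<beta>" "f = 3 + 2 * \<beta>"
  have pos: "e > 0" "f > 0" using \<beta> by (auto simp: ef)
  have ef9: "e * f = 9 - 4 * \<beta>\<^sup>2" by (simp add: ef algebra_simps power2_eq_square)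
  have b1: "\<beta>\<^sup>2 < 1" using \<beta> by (simp add: abs_square_less_1)
  define x y where xy: "x = Re \<tau>" "y = Im \<tau>"
  have xy1: "x\<^sup>2 + y\<^sup>2 = 1" using \<tau> cmod_power2[of \<tau>] by (simp add: xy)
  define W where "W = x\<^sup>2 / f + y\<^sup>2 / e"
  have W: "W > 0"
  proof -
    have "W \<ge> 0" using pos by (simp add: W_def)
    moreover have "W \<noteq> 0"
    proof
      assume "W = 0"
      hence "x\<^sup>2 / f = 0" "y\<^sup>2 / e = 0"
        using pos by (simp_all add: W_def add_nonneg_eq_0_iff)
      thus False using pos xy1 by simp
    qed
    ultimately show ?thesis by simp
  qed
  \<comment> \<open>The right-hand side 1 / (9 e f) of the centred (p, q)-equation, multiplied by
    the factor 36 \<beta>^2 W of the identity, is m^2.\<close>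
  define m where "m = sqrt (4 * \<beta>\<^sup>2 * W / (e * f))"
  have m: "m > 0" "m\<^sup>2 = 4 * \<beta>\<^sup>2 * W / (e * f)" using W pos \<beta> by (simp_all add: m_def)
  \<comment> \<open>The centre of the (p, q)-ellipse is (p0, 0), by completing the square in
    p.\<close>
  define p0 where "p0 = 1 / (e * f)"
  define c where "c = Complex (2 * \<beta> * e * x * p0) (2 * \<beta> * f * y * p0)"
  define g where "g p q = Complex (2 * \<beta> * e * x * p - 6 * \<beta> * y * q) (2 * \<beta> * f * y * p + 6 * \<beta> * x * q)" for p q
  have on_ellipse: "g p q \<in> axis_ellipse c (sqrt e * m) (sqrt f * m) \<longleftrightarrow> e * f / 9 * p\<^sup>2 + q\<^sup>2 = 2 * p / 9" for p q
  proof -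
    have 1: "Re (g p q) - Re c = 2 * \<beta> * e * x * (p - p0) - 6 * \<beta> * y * q"
      "Im (g p q) - Im c = 2 * \<beta> * f * y * (p - p0) + 6 * \<beta> * x * q"
      by (simp_all add: g_def c_def algebra_simps)
    have nz: "36 * \<beta>\<^sup>2 * W \<noteq> 0" using \<beta> W by simp
    have eqm: "t / m\<^sup>2 = 1 \<longleftrightarrow> t = 4 * \<beta>\<^sup>2 * W / (e * f)" for t
      using m(1) unfolding m(2)[symmetric] by auto
    have "g p q \<in> axis_ellipse c (sqrt e * m) (sqrt f * m) \<longleftrightarrow>
      ((2 * \<beta> * e * x * (p - p0) - 6 * \<beta> * y * q)\<^sup>2 / e + (2 * \<beta> * f * y * (p - p0) + 6 * \<beta> * x * q)\<^sup>2 / f) / m\<^sup>2 = 1"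
      unfolding axis_ellipse_def mem_Collect_eq 1 power_divide power_mult_distrib
      using pos by (simp add: add_divide_distrib)
    also have "\<dots> \<longleftrightarrow> 36 * \<beta>\<^sup>2 * W * (e * f / 9 * (p - p0)\<^sup>2 + q\<^sup>2) = 4 * \<beta>\<^sup>2 * W / (e * f)"
      unfolding rotated_ellipse_identity[OF pos] W_def[symmetric] eqm ..
    also have "4 * \<beta>\<^sup>2 * W / (e * f) = 36 * \<beta>\<^sup>2 * W * (1 / (9 * (e * f)))" by simp
    also have "36 * \<beta>\<^sup>2 * W * (e * f / 9 * (p - p0)\<^sup>2 + q\<^sup>2) = 36 * \<beta>\<^sup>2 * W * (1 / (9 * (e * f)))
      \<longleftrightarrow> e * f / 9 * (p - p0)\<^sup>2 + q\<^sup>2 = 1 / (9 * (e * f))"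
      using nz by (simp only: mult_cancel_left simp_thms)
    also have "e * f / 9 * (p - p0)\<^sup>2 = e * f / 9 * p\<^sup>2 - 2 * p / 9 + 1 / (9 * (e * f))"
      using pos by (simp add: p0_def field_simps power2_eq_square)
    finally show ?thesis by auto
  qed
  have surj: "\<exists>p q. z = g p q" for z
  proof -
    \<comment> \<open>The linear map \<open>g\<close> has determinant 12 \<beta>^2 D; p and q below
      come from Cramer's rule.\<close>
    define D where "D = e * x\<^sup>2 + f * y\<^sup>2"
    have "e * f * W = D" using pos by (simp add: W_def D_def field_simps)
    hence D: "D > 0" using pos W by (metis mult_pos_pos)
    define p q where pq: "p = (x * Re z + y * Im z) / (2 * \<beta> * D)"
      "q = (e * x * Im z - f * y * Re z) / (6 * \<beta> * D)"
    have A: "2 * \<beta> * p * D = x * Re z + y * Im z" "6 * \<beta> * q * D = e * x * Im z - f * y * Re z"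
      using \<beta> D by (simp_all add: pq)
    have "(e * x * (2 * \<beta> * p) - y * (6 * \<beta> * q)) * D = e * x * (2 * \<beta> * p * D) - y * (6 * \<beta> * q * D)"
      "(f * y * (2 * \<beta> * p) + x * (6 * \<beta> * q)) * D = f * y * (2 * \<beta> * p * D) + x * (6 * \<beta> * q * D)"
      by (simp_all add: algebra_simps)
    moreover have "e * x * (x * Re z + y * Im z) - y * (e * x * Im z - f * y * Re z) = Re z * D"
      "f * y * (x * Re z + y * Im z) + x * (e * x * Im z - f * y * Re z) = Im z * D"
      by (simp_all add: D_def algebra_simps power2_eq_square)
    ultimately have "(e * x * (2 * \<beta> * p) - y * (6 * \<beta> * q)) * D = Re z * D"
      "(f * y * (2 * \<beta> * p) + x * (6 * \<beta> * q)) * D = Im z * D"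
      unfolding A by simp_all
    hence "e * x * (2 * \<beta> * p) - y * (6 * \<beta> * q) = Re z" "f * y * (2 * \<beta> * p) + x * (6 * \<beta> * q) = Im z"
      using D by simp_all
    hence "z = g p q" using D by (simp add: g_def complex_eq_iff algebra_simps)
    thus ?thesis by blast
  qed
  have coord: "gergonne_coord (\<tau> * \<mu>) (of_real \<beta> * \<tau> + \<tau> * \<mu> * of_real \<beta>)
      = g ((1 + Re \<mu>) / (9 - 2 * \<beta>\<^sup>2 * (1 + Re \<mu>))) (Im \<mu> / (9 - 2 * \<beta>\<^sup>2 * (1 + Re \<mu>)))"
    if "cmod \<mu> = 1" for \<mu>
    unfolding gergonne_coord_polar[OF \<tau> that] g_def ef xy ..
  have "{gergonne_coord l (of_real \<beta> * \<tau> + l * of_real \<beta>) | l. cmod l = 1}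
      = axis_ellipse c (sqrt e * m) (sqrt f * m)" (is "?L = ?E")
  proof (intro equalityI subsetI)
    fix z assume "z \<in> ?L"
    then obtain l where l: "cmod l = 1" "z = gergonne_coord l (of_real \<beta> * \<tau> + l * of_real \<beta>)" by blast
    define \<mu> where "\<mu> = l / \<tau>"
    have "l = \<tau> * \<mu>" "cmod \<mu> = 1" using \<tau> l(1) by (auto simp: \<mu>_def norm_divide)
    thus "z \<in> ?E"
      using coord circle_point_rational[of \<mu> \<beta>] b1 unfolding l(2) by (simp add: on_ellipse ef9)
  next
    fix z assume z: "z \<in> ?E"
    obtain p q where g: "z = g p q" using surj by blast
    hence "(9 - 4 * \<beta>\<^sup>2) / 9 * p\<^sup>2 + q\<^sup>2 = 2 * p / 9" using z on_ellipse ef9 by simp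
    then obtain \<mu> where \<mu>: "cmod \<mu> = 1" "p = (1 + Re \<mu>) / (9 - 2 * \<beta>\<^sup>2 * (1 + Re \<mu>))"
      "q = Im \<mu> / (9 - 2 * \<beta>\<^sup>2 * (1 + Re \<mu>))"
      using rational_circle_point b1 by blast
    have "z = gergonne_coord (\<tau> * \<mu>) (of_real \<beta> * \<tau> + \<tau> * \<mu> * of_real \<beta>)"
      unfolding coord[OF \<mu>(1)] g \<mu>(2,3) ..
    moreover have "cmod (\<tau> * \<mu>) = 1" using \<tau> \<mu>(1) by (simp add: norm_mult)
    ultimately show "z \<in> ?L" by blast
  qed
  thus ?thesis using that m(1) unfolding ef by blast
qed

section \<open>Circles centred on the ellipse of equilateral centroids\<close>

lemma axis_ellipse_similar:
  assumes "0 < r" "0 < h" "0 < k"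
  shows "(\<lambda>z. C + of_real r * z) ` axis_ellipse p h k = axis_ellipse (C + of_real r * p) (r * h) (r * k)"
proof (intro equalityI subsetI)
  fix z assume z: "z \<in> axis_ellipse (C + of_real r * p) (r * h) (r * k)"
  define w where "w = (z - C) / of_real r"
  have w: "z = C + of_real r * w" using assms(1) by (simp add: w_def)
  have "Re z - Re (C + of_real r * p) = r * (Re w - Re p)" "Im z - Im (C + of_real r * p) = r * (Im w - Im p)"
    by (simp_all add: w algebra_simps)
  hence "w \<in> axis_ellipse p h k" using z assms(1) by (simp add: axis_ellipse_def)
  thus "z \<in> (\<lambda>z. C + of_real r * z) ` axis_ellipse p h k" using w by blast
next
  fix z assume "z \<in> (\<lambda>z. C + of_real r * z) ` axis_ellipse p h k"
  then obtain w where w: "z = C + of_real r * w" "w \<in> axis_ellipse p h k" by blast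
  have "Re z - Re (C + of_real r * p) = r * (Re w - Re p)" "Im z - Im (C + of_real r * p) = r * (Im w - Im p)"
    by (simp_all add: w algebra_simps)
  thus "z \<in> axis_ellipse (C + of_real r * p) (r * h) (r * k)"
    using w(2) assms(1) by (simp add: axis_ellipse_def)
qed

text \<open>Substituting C + r z, the coefficients of the squared coordinates split into a multiple
  of |z|^2 and one of Re (z^2). The factor 4 / \<delta> makes the constant term - 4; \<delta> > 0
  says that C is interior.\<close>

lemma poncelet_conic_ellipse:
  fixes a b r :: real and C :: complex
  assumes "a \<noteq> 0" "b \<noteq> 0"
  defines "\<delta> \<equiv> 1 - (Re C / a)\<^sup>2 - (Im C / b)\<^sup>2"
  defines "g \<equiv> r\<^sup>2 / (\<delta> * a\<^sup>2 * b\<^sup>2)"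
  assumes "\<delta> > 0"
  shows "poncelet_conic (2 * g * (a\<^sup>2 + b\<^sup>2)) (Complex (2 * r * Re C / (\<delta> * a\<^sup>2)) (2 * r * Im C / (\<delta> * b\<^sup>2)))
      (g * (a\<^sup>2 - b\<^sup>2)) z
    = 4 / \<delta> * ((Re (C + of_real r * z) / a)\<^sup>2 + (Im (C + of_real r * z) / b)\<^sup>2 - 1)"
proof -
  obtain x y where z: "z = Complex x y" by (cases z)
  have "2 * g * (a\<^sup>2 + b\<^sup>2) * (x\<^sup>2 + y\<^sup>2) - 2 * (g * (a\<^sup>2 - b\<^sup>2)) * (x\<^sup>2 - y\<^sup>2)
      = 4 * (g * b\<^sup>2) * x\<^sup>2 + 4 * (g * a\<^sup>2) * y\<^sup>2"
    by (simp add: algebra_simps)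
  also have "g * b\<^sup>2 = r\<^sup>2 / (\<delta> * a\<^sup>2)" using assms by (simp add: g_def)
  also have "g * a\<^sup>2 = r\<^sup>2 / (\<delta> * b\<^sup>2)" using assms by (simp add: g_def)
  finally have 1: "2 * g * (a\<^sup>2 + b\<^sup>2) * (x\<^sup>2 + y\<^sup>2) - 2 * (g * (a\<^sup>2 - b\<^sup>2)) * (x\<^sup>2 - y\<^sup>2)
      = 4 * (r\<^sup>2 / (\<delta> * a\<^sup>2)) * x\<^sup>2 + 4 * (r\<^sup>2 / (\<delta> * b\<^sup>2)) * y\<^sup>2" .
  have "(Re C + r * x)\<^sup>2 / a\<^sup>2 + (Im C + r * y)\<^sup>2 / b\<^sup>2 - 1
      = r\<^sup>2 / a\<^sup>2 * x\<^sup>2 + 2 * r * Re C / a\<^sup>2 * x + r\<^sup>2 / b\<^sup>2 * y\<^sup>2 + 2 * r * Im C / b\<^sup>2 * y - \<delta>"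
    by (simp add: \<delta>_def power2_sum add_divide_distrib power_mult_distrib power_divide ac_simps)
  hence 2: "4 / \<delta> * ((Re C + r * x)\<^sup>2 / a\<^sup>2 + (Im C + r * y)\<^sup>2 / b\<^sup>2 - 1)
      = 4 * (r\<^sup>2 / (\<delta> * a\<^sup>2)) * x\<^sup>2 + 4 * (r\<^sup>2 / (\<delta> * b\<^sup>2)) * y\<^sup>2
        + 4 * (2 * r * Re C / (\<delta> * a\<^sup>2) * x + 2 * r * Im C / (\<delta> * b\<^sup>2) * y) - 4"
    using assms(5) by (simp add: distrib_left right_diff_distrib)
  have "(cmod z)\<^sup>2 = x\<^sup>2 + y\<^sup>2" by (simp add: z cmod_power2)
  moreover have "Re (z\<^sup>2) = x\<^sup>2 - y\<^sup>2" by (simp add: z power2_eq_square)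
  ultimately show ?thesis
    unfolding poncelet_conic_def power_divide using 1 2 by (simp add: z)
qed

text \<open>(a^2 + 3 b^2)^2 = 8 (a^2 + b^2) b^2 + c^4 and (3 a^2 + b^2)^2 = 8 (a^2 + b^2) a^2 + c^4
  rewrite the equation of the ellipse into the second claim. If \<delta> \<le> 0, that claim forces
  C = 0, where \<delta> = 1.\<close>

lemma equilateral_centroid_ellipse:
  fixes a b c :: real
  assumes "0 < b" "b < a" "c\<^sup>2 = a\<^sup>2 - b\<^sup>2"
    and C: "C \<in> axis_ellipse 0 (a * c\<^sup>2 / (a\<^sup>2 + 3 * b\<^sup>2)) (b * c\<^sup>2 / (3 * a\<^sup>2 + b\<^sup>2))"
  defines "\<delta> \<equiv> 1 - (Re C / a)\<^sup>2 - (Im C / b)\<^sup>2"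
  shows "\<delta> > 0"
    and "8 * (a\<^sup>2 + b\<^sup>2) * (b\<^sup>2 * (Re C / a)\<^sup>2 + a\<^sup>2 * (Im C / b)\<^sup>2) = (c\<^sup>2)\<^sup>2 * \<delta>"
proof -
  define X Y where XY: "X = (Re C / a)\<^sup>2" "Y = (Im C / b)\<^sup>2"
  have c: "c\<^sup>2 > 0" using assms by (simp add: power_strict_mono)
  have "(Re C / (a * c\<^sup>2 / (a\<^sup>2 + 3 * b\<^sup>2)))\<^sup>2 + (Im C / (b * c\<^sup>2 / (3 * a\<^sup>2 + b\<^sup>2)))\<^sup>2 = 1"
    using C by (simp add: axis_ellipse_def)
  moreover have "(Re C / (a * c\<^sup>2 / (a\<^sup>2 + 3 * b\<^sup>2)))\<^sup>2 = X * (a\<^sup>2 + 3 * b\<^sup>2)\<^sup>2 / (c\<^sup>2)\<^sup>2"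
    "(Im C / (b * c\<^sup>2 / (3 * a\<^sup>2 + b\<^sup>2)))\<^sup>2 = Y * (3 * a\<^sup>2 + b\<^sup>2)\<^sup>2 / (c\<^sup>2)\<^sup>2"
    by (simp_all add: XY power_mult_distrib power_divide)
  ultimately have "(X * (a\<^sup>2 + 3 * b\<^sup>2)\<^sup>2 + Y * (3 * a\<^sup>2 + b\<^sup>2)\<^sup>2) / (c\<^sup>2)\<^sup>2 = 1"
    by (simp add: add_divide_distrib)
  hence "X * (a\<^sup>2 + 3 * b\<^sup>2)\<^sup>2 + Y * (3 * a\<^sup>2 + b\<^sup>2)\<^sup>2 = (c\<^sup>2)\<^sup>2" using c by (simp add: divide_eq_eq)
  moreover have "(a\<^sup>2 + 3 * b\<^sup>2)\<^sup>2 = 8 * (a\<^sup>2 + b\<^sup>2) * b\<^sup>2 + (c\<^sup>2)\<^sup>2"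
    "(3 * a\<^sup>2 + b\<^sup>2)\<^sup>2 = 8 * (a\<^sup>2 + b\<^sup>2) * a\<^sup>2 + (c\<^sup>2)\<^sup>2"
    unfolding assms(3) by (simp_all add: algebra_simps power2_eq_square)
  ultimately have eq: "8 * (a\<^sup>2 + b\<^sup>2) * (b\<^sup>2 * X + a\<^sup>2 * Y) = (c\<^sup>2)\<^sup>2 * \<delta>"
    by (simp add: \<delta>_def XY[symmetric] algebra_simps)
  thus "8 * (a\<^sup>2 + b\<^sup>2) * (b\<^sup>2 * (Re C / a)\<^sup>2 + a\<^sup>2 * (Im C / b)\<^sup>2) = (c\<^sup>2)\<^sup>2 * \<delta>" by (simp add: XY)
  have nn: "X \<ge> 0" "Y \<ge> 0" by (simp_all add: XY)
  have ab: "a\<^sup>2 > 0" "b\<^sup>2 > 0" using assms by auto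
  show "\<delta> > 0"
  proof (rule ccontr)
    assume "\<not> \<delta> > 0"
    hence "(c\<^sup>2)\<^sup>2 * \<delta> \<le> 0" using c by (simp add: mult_nonneg_nonpos)
    hence "8 * (a\<^sup>2 + b\<^sup>2) * (b\<^sup>2 * X + a\<^sup>2 * Y) \<le> 0" unfolding eq .
    moreover have "8 * (a\<^sup>2 + b\<^sup>2) > 0" by (intro mult_pos_pos add_pos_pos ab) simp
    ultimately have "b\<^sup>2 * X + a\<^sup>2 * Y \<le> 0" by (metis mult_pos_pos not_le)
    moreover have "b\<^sup>2 * X \<ge> 0" "a\<^sup>2 * Y \<ge> 0" using nn ab by auto
    ultimately have "b\<^sup>2 * X = 0" "a\<^sup>2 * Y = 0" by linarith+
    hence "X = 0" "Y = 0" using ab by auto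
    hence "\<delta> = 1" unfolding \<delta>_def XY[symmetric] by simp
    thus False using \<open>\<not> \<delta> > 0\<close> by simp
  qed
qed

(* The closure relation is a quadratic equation for g = r^2 / (\<delta> a^2 b^2); its second root
   belongs to a circle that is not nested in the ellipse. *)
lemma nested_closure_root:
  fixes g n c2 :: real and \<alpha> :: complex
  assumes "0 < c2" "c2 < n"
    and \<alpha>: "(cmod \<alpha>)\<^sup>2 = g * c2\<^sup>2 / (2 * n)"
    and k: "2 * g * n = 1 + (g * c2)\<^sup>2 - (cmod \<alpha>)\<^sup>2"
    and nested: "\<And>z. cmod z = 1 \<Longrightarrow> poncelet_conic (2 * g * n) \<alpha> (g * c2) z < 0"
  shows "g = 1 / (2 * n)"
proof -
  have n: "n > 0" using assms by simp
  \<comment> \<open>After substitution for |\<alpha>|^2 the closure relation splits into linear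
    factors in g.\<close>
  have "(2 * n * g - 1) * (g * c2\<^sup>2 - 2 * n) = 2 * n * (1 + (g * c2)\<^sup>2 - g * c2\<^sup>2 / (2 * n) - 2 * g * n)"
    using n by (simp add: field_simps power2_eq_square)
  also have "\<dots> = 0" using k \<alpha> by simp
  finally have "2 * n * g = 1 \<or> g * c2\<^sup>2 = 2 * n" by auto
  moreover have "g * c2\<^sup>2 \<noteq> 2 * n"
  proof
    assume g: "g * c2\<^sup>2 = 2 * n"
    hence "(cmod \<alpha>)\<^sup>2 = 1" using \<alpha> n by simp
    hence a: "cmod \<alpha> = 1" using norm_ge_zero[of \<alpha>] by (auto simp: power2_eq_1_iff)
    have "g * c2 * c2 > 2 * c2" using g assms by (simp add: power2_eq_square mult.assoc)
    hence gc: "g * c2 > 2" using assms(1) by simp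
    \<comment> \<open>At the unit number z = \<alpha> the second modulus is 1, while the first is at
      least g c2 - 1 > 1.\<close>
    have "poncelet_conic (2 * g * n) \<alpha> (g * c2) \<alpha> < 0" using nested a by blast
    hence "cmod (\<alpha> - of_real (g * c2) * cnj \<alpha>) < cmod (2 - cnj \<alpha> * \<alpha>)"
      unfolding k poncelet_conic_eq by (simp add: power2_less_imp_less)
    moreover have "cnj \<alpha> * \<alpha> = 1" using a complex_norm_square[of \<alpha>] by (simp add: mult.commute)
    moreover have "g * c2 - 1 \<le> cmod (\<alpha> - of_real (g * c2) * cnj \<alpha>)"
      using norm_triangle_ineq2[of "of_real (g * c2) * cnj \<alpha>" \<alpha>] a gc
      by (simp add: norm_mult norm_minus_commute del: of_real_mult)
    ultimately show False using gc by simp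
  qed
  ultimately show ?thesis using n by (simp add: field_simps)
qed

lemma sphere_coordinate:
  assumes "0 < r" "x \<in> sphere C r"
  obtains z where "cmod z = 1" "x = C + of_real r * z"
proof
  show "cmod ((x - C) / of_real r) = 1"
    using assms by (simp add: norm_divide dist_norm norm_minus_commute)
  show "x = C + of_real r * ((x - C) / of_real r)" using assms(1) by simp
qed

lemma gergonne_locus_equilateral:
  fixes a b c :: real
  assumes ab: "0 < b" "b < a" and c: "c\<^sup>2 = a\<^sup>2 - b\<^sup>2"
    and C: "C \<in> axis_ellipse 0 (a * c\<^sup>2 / (a\<^sup>2 + 3 * b\<^sup>2)) (b * c\<^sup>2 / (3 * a\<^sup>2 + b\<^sup>2))"
  defines "\<beta> \<equiv> c\<^sup>2 / (2 * (a\<^sup>2 + b\<^sup>2))"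
  obtains p m where "m > 0"
    "gergonne_locus a b C = axis_ellipse p (sqrt (3 - 2 * \<beta>) * m) (sqrt (3 + 2 * \<beta>) * m)"
proof -
  define n c2 where nc: "n = a\<^sup>2 + b\<^sup>2" "c2 = a\<^sup>2 - b\<^sup>2"
  define \<delta> where "\<delta> = 1 - (Re C / a)\<^sup>2 - (Im C / b)\<^sup>2"
  define g where "g r = r\<^sup>2 / (\<delta> * a\<^sup>2 * b\<^sup>2)" for r
  define \<alpha> where "\<alpha> r = Complex (2 * r * Re C / (\<delta> * a\<^sup>2)) (2 * r * Im C / (\<delta> * b\<^sup>2))" for r
  have a0: "a > 0" using ab by simp
  have sq: "a\<^sup>2 > 0" "b\<^sup>2 > 0" using a0 ab by simp_all
  have "b\<^sup>2 < a\<^sup>2" using ab by (simp add: power_strict_mono)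
  hence c2: "0 < c2" "c2 < n" using ab by (simp_all add: nc)
  hence n: "n > 0" by simp
  have \<delta>: "\<delta> > 0"
    and E: "8 * n * (b\<^sup>2 * (Re C / a)\<^sup>2 + a\<^sup>2 * (Im C / b)\<^sup>2) = c2\<^sup>2 * \<delta>"
    using equilateral_centroid_ellipse[OF ab c C] unfolding \<delta>_def nc c by simp_all
  have \<beta>1: "\<beta> = c2 / (2 * n)" by (simp only: \<beta>_def c nc)
  have \<beta>: "0 < \<beta>" "\<beta> < 1/2" unfolding \<beta>1 using c2 by (simp_all add: divide_less_eq)
  \<comment> \<open>On this ellipse of centres, |\<alpha>| depends on C only through
    \<open>g r\<close>.\<close>
  have \<alpha>_sq: "(cmod (\<alpha> r))\<^sup>2 = g r * c2\<^sup>2 / (2 * n)" for r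
  proof -
    define u v where uv: "u = Re C / a" "v = Im C / b"
    have "\<alpha> r = Complex (2 * r * u / (\<delta> * a)) (2 * r * v / (\<delta> * b))"
      using a0 ab by (simp add: \<alpha>_def uv power2_eq_square)
    hence "(cmod (\<alpha> r))\<^sup>2 = 4 * r\<^sup>2 / \<delta>\<^sup>2 * (u\<^sup>2 / a\<^sup>2 + v\<^sup>2 / b\<^sup>2)"
      by (simp add: cmod_power2 power_divide power_mult_distrib distrib_left)
    also have "u\<^sup>2 / a\<^sup>2 + v\<^sup>2 / b\<^sup>2 = (b\<^sup>2 * u\<^sup>2 + a\<^sup>2 * v\<^sup>2) / (a\<^sup>2 * b\<^sup>2)"
      using sq by (simp add: add_divide_distrib)
    also have "b\<^sup>2 * u\<^sup>2 + a\<^sup>2 * v\<^sup>2 = c2\<^sup>2 * \<delta> / (8 * n)"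
      using E n by (simp add: uv eq_divide_eq mult.commute)
    also have "4 * r\<^sup>2 / \<delta>\<^sup>2 * (c2\<^sup>2 * \<delta> / (8 * n) / (a\<^sup>2 * b\<^sup>2)) = g r * c2\<^sup>2 / (2 * n)"
      using \<delta> sq n by (simp add: g_def field_simps power2_eq_square)
    finally show ?thesis .
  qed
  have conic: "poncelet_conic (2 * g r * n) (\<alpha> r) (g r * c2) z
      = 4 / \<delta> * ((Re (C + of_real r * z) / a)\<^sup>2 + (Im (C + of_real r * z) / b)\<^sup>2 - 1)" for r z
    using poncelet_conic_ellipse[of a b C r z] a0 ab \<delta> unfolding \<delta>_def g_def \<alpha>_def nc by simp
  have \<delta>4: "4 / \<delta> * (t - 1) = 0 \<longleftrightarrow> t = 1" "4 / \<delta> * (t - 1) < 0 \<longleftrightarrow> t < 1" for t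
    unfolding mult_eq_0_iff mult_less_0_iff using \<delta> by auto
  have on_ellipse: "C + of_real r * z \<in> axis_ellipse 0 a b \<longleftrightarrow> poncelet_conic (2 * g r * n) (\<alpha> r) (g r * c2) z = 0"
    for r z unfolding conic axis_ellipse_def \<delta>4 by simp
  have in_ellipse: "C + of_real r * z \<in> axis_ellipse_interior 0 a b \<longleftrightarrow> poncelet_conic (2 * g r * n) (\<alpha> r) (g r * c2) z < 0"
    for r z unfolding conic axis_ellipse_interior_def \<delta>4 by simp
  \<comment> \<open>The radius with \<open>g r0 = 1 / (2 * n)\<close>, the root kept by
    \<open>nested_closure_root\<close>.\<close>
  define r0 where "r0 = sqrt (\<delta> * a\<^sup>2 * b\<^sup>2 / (2 * n))"
  have r0: "r0 > 0" using \<delta> sq n by (simp add: r0_def)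
  have g0: "g r = 1 / (2 * n) \<longleftrightarrow> r = r0" if "r > 0" for r
  proof -
    have "g r = 1 / (2 * n) \<longleftrightarrow> r\<^sup>2 = r0\<^sup>2"
      using \<delta> sq n by (simp add: g_def r0_def divide_eq_eq)
    thus ?thesis using that r0 by (simp add: power2_eq_iff_nonneg)
  qed
  have g1: "g r0 = 1 / (2 * n)" using g0 r0 by simp
  hence gb: "g r0 * c2 = \<beta>" "2 * g r0 * n = 1" using c2 by (simp_all add: \<beta>1)
  \<comment> \<open>At this radius g c2^2 / (2 n) is the square of c2 / (2 n) = \<beta>, so the
    polar form with |\<alpha>| = \<beta> applies.\<close>
  have "(cmod (\<alpha> r0))\<^sup>2 = \<beta>\<^sup>2" unfolding \<alpha>_sq g1 \<beta>1 by (simp add: power2_eq_square)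
  hence \<alpha>0: "cmod (\<alpha> r0) = \<beta>" using \<beta>(1) by (simp add: power2_eq_iff_nonneg)
  hence k0: "2 * g r0 * n = 1 + \<beta>\<^sup>2 - (cmod (\<alpha> r0))\<^sup>2" using gb by simp
  define \<tau> where "\<tau> = \<alpha> r0 / of_real \<beta>"
  have \<tau>: "cmod \<tau> = 1" "\<alpha> r0 = of_real \<beta> * \<tau>" using \<alpha>0 \<beta>(1) by (simp_all add: \<tau>_def norm_divide)
  have acute: "cmod (\<alpha> r0 + l * of_real \<beta>) < 1" if "cmod l = 1" for l
    using norm_triangle_ineq[of "\<alpha> r0" "l * of_real \<beta>"] that \<alpha>0 \<beta> by (simp add: norm_mult)
  define L where "L = {gergonne_coord l (of_real \<beta> * \<tau> + l * of_real \<beta>) | l. cmod l = 1}"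
  have "gergonne_locus a b C = (\<lambda>z. C + of_real r0 * z) ` L"
  proof (intro equalityI subsetI)
    \<comment> \<open>Closure and nestedness force the radius \<open>r0\<close> and the sum of the
      contact points.\<close>
    fix X assume "X \<in> gergonne_locus a b C"
    then obtain P Q R r where PQR: "P \<in> axis_ellipse 0 a b" "Q \<in> axis_ellipse 0 a b" "R \<in> axis_ellipse 0 a b"
      and inc: "is_incircle C r P Q R" and nested: "sphere C r \<subseteq> axis_ellipse_interior 0 a b"
      and X: "is_gergonne_point P Q R X"
      unfolding gergonne_locus_def poncelet_family_def by blast
    have r: "r > 0" using inc by (simp add: is_incircle_def)
    obtain u v w where unit: "cmod u = 1" "cmod v = 1" "cmod w = 1" and ne: "u \<noteq> v" "v \<noteq> w" "w \<noteq> u"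
      and nz: "u + v \<noteq> 0" "v + w \<noteq> 0" "w + u \<noteq> 0"
      and vert: "P = C + of_real r * tangent_meet v w" "Q = C + of_real r * tangent_meet w u"
        "R = C + of_real r * tangent_meet u v"
      and XK: "cmod (u + v + w) < 3 \<Longrightarrow> X = C + of_real r * gergonne_coord (u * v * w) (u + v + w)"
      using gergonne_point_coord[OF inc X] by blast
    note cl = poncelet_closure[OF unit ne nz PQR[unfolded vert on_ellipse]]
    have "poncelet_conic (2 * g r * n) (\<alpha> r) (g r * c2) z < 0" if "cmod z = 1" for z
    proof -
      have "C + of_real r * z \<in> sphere C r" using that r by (simp add: dist_norm norm_mult)
      thus ?thesis using nested in_ellipse by blast
    qed
    hence "g r = 1 / (2 * n)"
      using nested_closure_root[OF c2(1,2) \<alpha>_sq cl(2)] by blast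
    hence rr: "r = r0" using g0 r by simp
    define l where "l = u * v * w"
    have l: "cmod l = 1" using unit by (simp add: l_def norm_mult)
    have s: "u + v + w = of_real \<beta> * \<tau> + l * of_real \<beta>"
      using cl(1) unfolding rr gb \<tau>(2) l_def .
    have "cmod (u + v + w) < 3" using acute[OF l] unfolding s \<tau>(2) by simp
    hence "X = C + of_real r0 * gergonne_coord l (of_real \<beta> * \<tau> + l * of_real \<beta>)"
      using XK unfolding rr s l_def by blast
    thus "X \<in> (\<lambda>z. C + of_real r0 * z) ` L" using l unfolding L_def by blast
  next
    \<comment> \<open>Conversely the Blaschke equation supplies contact points for every unit l;
      their sum has modulus below 1, so they are those of a genuine incircle.\<close>
    fix X assume "X \<in> (\<lambda>z. C + of_real r0 * z) ` L"
    then obtain l where l: "cmod l = 1"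
      and X: "X = C + of_real r0 * gergonne_coord l (\<alpha> r0 + l * of_real \<beta>)"
      unfolding L_def \<tau>(2) by blast
    obtain u v w where unit: "cmod u = 1" "cmod v = 1" "cmod w = 1" and ne: "u \<noteq> v" "v \<noteq> w" "w \<noteq> u"
      and p: "u * v * w = l" and s: "u + v + w = \<alpha> r0 + l * of_real \<beta>"
      using blaschke_roots[OF l, of "\<alpha> r0" \<beta>] \<alpha>0 \<beta>(2) by auto
    have lt: "cmod (u + v + w) < 1" unfolding s by (rule acute[OF l])
    have vertex: "C + of_real r0 * tangent_meet v w \<in> axis_ellipse 0 a b"
      if "cmod u = 1" "cmod v = 1" "cmod w = 1" "u * v * w = l" "u + v + w = \<alpha> r0 + l * of_real \<beta>" for u v w
    proof -
      have "v + w \<noteq> 0" using unit_sum_nonzero[of u v w] that(1) acute[OF l] unfolding that(5)[symmetric]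
        by (simp add: ac_simps)
      thus ?thesis unfolding on_ellipse gb(1)
        using poncelet_conic_vertex[OF that(1-3) _ _ k0] that(4,5) by simp
    qed
    have "sphere C r0 \<subseteq> axis_ellipse_interior 0 a b"
    proof
      fix x assume "x \<in> sphere C r0"
      then obtain z where "cmod z = 1" "x = C + of_real r0 * z" using sphere_coordinate[OF r0] by blast
      thus "x \<in> axis_ellipse_interior 0 a b"
        using poncelet_conic_unit_neg[of "\<alpha> r0" \<beta> z] \<alpha>0 \<beta>(2) by (simp add: in_ellipse gb(1) k0)
    qed
    moreover have "C + of_real r0 * tangent_meet v w \<in> axis_ellipse 0 a b"
      using vertex[of u v w] unit p s by simp
    moreover have "C + of_real r0 * tangent_meet w u \<in> axis_ellipse 0 a b"
      using vertex[of v w u] unit p s by (simp add: ac_simps)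
    moreover have "C + of_real r0 * tangent_meet u v \<in> axis_ellipse 0 a b"
      using vertex[of w u v] unit p s by (simp add: ac_simps)
    ultimately show "X \<in> gergonne_locus a b C"
      using is_incircle_tangent_meet(1)[OF r0 unit lt ne(1), of C] gergonne_pointI[OF r0 unit lt ne, of C]
      unfolding gergonne_locus_def poncelet_family_def X p s by blast
  qed
  moreover obtain p m where m: "m > 0" "L = axis_ellipse p (sqrt (3 - 2 * \<beta>) * m) (sqrt (3 + 2 * \<beta>) * m)"
    by (rule gergonne_coord_locus[OF \<tau>(1) \<beta>, folded L_def])
  moreover have "0 < sqrt (3 - 2 * \<beta>) * m" "0 < sqrt (3 + 2 * \<beta>) * m" using \<beta> m(1) by simp_all
  ultimately have "gergonne_locus a b C = axis_ellipse (C + of_real r0 * p)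
      (r0 * (sqrt (3 - 2 * \<beta>) * m)) (r0 * (sqrt (3 + 2 * \<beta>) * m))"
    by (simp only: axis_ellipse_similar[OF r0])
  hence "gergonne_locus a b C = axis_ellipse (C + of_real r0 * p)
      (sqrt (3 - 2 * \<beta>) * (r0 * m)) (sqrt (3 + 2 * \<beta>) * (r0 * m))"
    by (simp only: mult.left_commute)
  thus ?thesis using that[of "r0 * m"] r0 m(1) by simp
qed

section \<open>The aspect ratio of the locus\<close>

theorem proposition13:
  fixes a b c :: real
  assumes "0 < b" and "b < a" and "c^2 = a^2 - b^2"
  shows "\<forall>C \<in> axis_ellipse 0 (a * c^2 / (a^2 + 3 * b^2)) (b * c^2 / (3 * a^2 + b^2)).
     (\<exists>p a\<^sub>7 b\<^sub>7. 0 < b\<^sub>7 \<and> b\<^sub>7 < a\<^sub>7 \<and> gergonne_locus a b C = axis_ellipse p b\<^sub>7 a\<^sub>7) \<and>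
     (\<forall>p a\<^sub>7 b\<^sub>7. 0 < b\<^sub>7 \<and> b\<^sub>7 \<le> a\<^sub>7 \<and> gergonne_locus a b C = axis_ellipse p b\<^sub>7 a\<^sub>7 \<longrightarrow>
        a\<^sub>7 / b\<^sub>7 = (2 * a^2 + b^2) / sqrt (2 * a^4 + 5 * a^2 * b^2 + 2 * b^4))"
proof
  fix C assume C: "C \<in> axis_ellipse 0 (a * c^2 / (a^2 + 3 * b^2)) (b * c^2 / (3 * a^2 + b^2))"
  define \<beta> where "\<beta> = c\<^sup>2 / (2 * (a\<^sup>2 + b\<^sup>2))"
  have sq: "0 < b\<^sup>2" "b\<^sup>2 < a\<^sup>2" using assms by (simp_all add: power_strict_mono)
  define n where "n = a\<^sup>2 + b\<^sup>2"
  have n: "c\<^sup>2 < n" "0 < c\<^sup>2" using sq by (simp_all add: n_def assms(3))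
  have n0: "n > 0" by (rule less_trans[OF n(2,1)])
  have \<beta>: "0 < \<beta>" "\<beta> < 1/2" unfolding \<beta>_def n_def[symmetric] using n n0 by (simp_all add: divide_less_eq)
  obtain p m where m: "m > 0"
    and loc: "gergonne_locus a b C = axis_ellipse p (sqrt (3 - 2 * \<beta>) * m) (sqrt (3 + 2 * \<beta>) * m)"
    using gergonne_locus_equilateral[OF assms C] unfolding \<beta>_def by blast
  have pos: "0 < sqrt (3 - 2 * \<beta>) * m" "sqrt (3 - 2 * \<beta>) * m < sqrt (3 + 2 * \<beta>) * m"
    using \<beta> m by simp_all
  have ratio: "sqrt (3 + 2 * \<beta>) / sqrt (3 - 2 * \<beta>) = (2 * a\<^sup>2 + b\<^sup>2) / sqrt (2 * a^4 + 5 * a\<^sup>2 * b\<^sup>2 + 2 * b^4)"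
  proof -
    \<comment> \<open>Multiplying 3 + 2 \<beta> and 3 - 2 \<beta> by n gives 2 A and 2 B, so the
      ratio is sqrt (A / B) = A / sqrt (A B).\<close>
    define A B where AB: "A = 2 * a\<^sup>2 + b\<^sup>2" "B = a\<^sup>2 + 2 * b\<^sup>2"
    have AB0: "A > 0" "B > 0"
      unfolding AB by (intro add_pos_pos mult_pos_pos sq(1) less_trans[OF sq] zero_less_numeral)+
    have "2 * \<beta> * n = c\<^sup>2" unfolding \<beta>_def n_def[symmetric] using n0 by simp
    hence "(3 + 2 * \<beta>) * n = 2 * A" "(3 - 2 * \<beta>) * n = 2 * B"
      unfolding AB by (simp_all add: distrib_right left_diff_distrib assms(3) n_def)
    hence "3 + 2 * \<beta> = 2 * A / n" "3 - 2 * \<beta> = 2 * B / n"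
      using n0 by (simp_all add: eq_divide_eq)
    hence "sqrt (3 + 2 * \<beta>) / sqrt (3 - 2 * \<beta>) = sqrt A / sqrt B"
      using n0 by (simp flip: real_sqrt_divide)
    also have "\<dots> = A / sqrt (A * B)"
      using AB0 by (simp add: real_sqrt_mult real_div_sqrt field_simps)
    also have "A * B = 2 * a^4 + 5 * a\<^sup>2 * b\<^sup>2 + 2 * b^4"
      by (simp add: AB algebra_simps power2_eq_square power4_eq_xxxx)
    finally show ?thesis by (simp only: AB)
  qed
  show "(\<exists>p a\<^sub>7 b\<^sub>7. 0 < b\<^sub>7 \<and> b\<^sub>7 < a\<^sub>7 \<and> gergonne_locus a b C = axis_ellipse p b\<^sub>7 a\<^sub>7) \<and>
     (\<forall>p a\<^sub>7 b\<^sub>7. 0 < b\<^sub>7 \<and> b\<^sub>7 \<le> a\<^sub>7 \<and> gergonne_locus a b C = axis_ellipse p b\<^sub>7 a\<^sub>7 \<longrightarrow>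
        a\<^sub>7 / b\<^sub>7 = (2 * a^2 + b^2) / sqrt (2 * a^4 + 5 * a^2 * b^2 + 2 * b^4))"
  proof (intro conjI allI impI)
    show "\<exists>p a\<^sub>7 b\<^sub>7. 0 < b\<^sub>7 \<and> b\<^sub>7 < a\<^sub>7 \<and> gergonne_locus a b C = axis_ellipse p b\<^sub>7 a\<^sub>7"
      using pos loc by blast
  next
    fix p' h k assume *: "0 < h \<and> h \<le> k \<and> gergonne_locus a b C = axis_ellipse p' h k"
    hence eq: "axis_ellipse p' h k = axis_ellipse p (sqrt (3 - 2 * \<beta>) * m) (sqrt (3 + 2 * \<beta>) * m)"
      and hk: "0 < h" "0 < k" using loc by auto
    have pos': "0 < sqrt (3 + 2 * \<beta>) * m" using pos by linarith
    \<comment> \<open>Inclusion in both directions bounds each semi-axis both ways, so the ratio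
      does not depend on how the locus is presented.\<close>
    have "h = sqrt (3 - 2 * \<beta>) * m" "k = sqrt (3 + 2 * \<beta>) * m"
      using axis_ellipse_semiaxes_le[OF hk pos(1) pos' equalityD1[OF eq]]
        axis_ellipse_semiaxes_le[OF pos(1) pos' hk equalityD2[OF eq]] by simp_all
    thus "k / h = (2 * a^2 + b^2) / sqrt (2 * a^4 + 5 * a^2 * b^2 + 2 * b^4)"
      using m ratio by simp
  qed
qed

end
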